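(* Consider an instance of the tree subtree-selection problem whose input is a collection of rooted trees $J_1,\dots,J_k$ with $n$ nodes in total, each node $j$ having an integer size $c_j$ and integer profit $p_j$, together with a size limit $C$; the goal is to select nodes $i_1,\dots,i_m$ whose rooted subtrees are pairwise non-overlapping, with $c_{i_1}+\dots+c_{i_m}\le C$ and $p_{i_1}+\dots+p_{i_m}$ maximal. Let $J_0$ be the tree obtained by adding a new root $r_0$ whose subtrees are $J_1,\dots,J_k$, and let $a_0(n)$ satisfy $\sum_j (p_j+c_j)\le a_0(n)$. Then there is an approximation scheme which, for every $\epsilon$ with $0<\epsilon<1$, computes a $(1+\epsilon)$-approximate solution in time $O\!\left(n\left(\frac{(\log \chi(J_0))(\log a_0(n))}{\epsilon}\right)^{2}\right)$.
   Context: $\chi(J_0)$ denotes the largest product of the node degrees along a path from the root to a leaf in $J_0$. A $(1+\epsilon)$-approximate solution is a feasible selection (pairwise non-overlapping subtrees, total size at most $C$) whose total profit is within a factor $1+\epsilon$ of the optimum.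
   Formalization: Each log in the time bound is read as max(1, log2), since for a single path log χ(J_0)=0 and the literal bound is 0; sizes, profits and C are nonnegative integers, since with negative values a_0(n) may be negative and its log undefined; ε is passed as a fraction in [ε/2, ε]. *)

theory Defs
  imports Complex_Main "HOL-Library.Disjoint_Sets"
begin

section \<open>Selecting subtrees of a rooted forest\<close>

text \<open>Nodes are named by natural numbers; sizes and profits are functions of the name.\<close>

datatype tree = Node (root: nat) (children: "tree list")

fun tree_nodes :: "tree \<Rightarrow> nat list" where
  "tree_nodes (Node j ts) = j # concat (map tree_nodes ts)"

fun subtrees :: "tree \<Rightarrow> tree set" where
  "subtrees (Node j ts) = insert (Node j ts) (\<Union>t\<in>set ts. subtrees t)"

definition forest_nodes :: "tree list \<Rightarrow> nat list" where
  "forest_nodes Js = concat (map tree_nodes Js)"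

definition forest_subtrees :: "tree list \<Rightarrow> tree set" where
  "forest_subtrees Js = (\<Union>t\<in>set Js. subtrees t)"

text \<open>The nodes of the subtree rooted at \<open>j\<close>. When the node names in \<open>Js\<close> are distinct,
  the union is over exactly one tree for each node \<open>j\<close> of \<open>Js\<close>.\<close>

definition rooted_subtree :: "tree list \<Rightarrow> nat \<Rightarrow> nat set" where
  "rooted_subtree Js j = (\<Union>t\<in>{t \<in> forest_subtrees Js. root t = j}. set (tree_nodes t))"

definition feasible :: "tree list \<Rightarrow> (nat \<Rightarrow> nat) \<Rightarrow> nat \<Rightarrow> nat set \<Rightarrow> bool" where
  "feasible Js c C S \<longleftrightarrow>
     S \<subseteq> set (forest_nodes Js) \<and> disjoint_family_on (rooted_subtree Js) S \<and> (\<Sum>j\<in>S. c j) \<le> C"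

definition optimum :: "tree list \<Rightarrow> (nat \<Rightarrow> nat) \<Rightarrow> (nat \<Rightarrow> nat) \<Rightarrow> nat \<Rightarrow> nat" where
  "optimum Js c p C = Max {\<Sum>j\<in>S. p j | S. feasible Js c C S}"

definition approx_solution ::
  "real \<Rightarrow> tree list \<Rightarrow> (nat \<Rightarrow> nat) \<Rightarrow> (nat \<Rightarrow> nat) \<Rightarrow> nat \<Rightarrow> nat set \<Rightarrow> bool" where
  "approx_solution \<epsilon> Js c p C S \<longleftrightarrow>
     feasible Js c C S \<and> real (optimum Js c p C) \<le> (1 + \<epsilon>) * real (\<Sum>j\<in>S. p j)"

fun leaf_paths :: "tree \<Rightarrow> tree list set" where
  "leaf_paths (Node j ts) =
     (if ts = [] then {[Node j ts]} else (\<Union>t\<in>set ts. (#) (Node j ts) ` leaf_paths t))"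

definition degree :: "tree \<Rightarrow> nat" where
  "degree t = length (children t)"

text \<open>The degree of a node of a rooted tree is its number of children. The final node of a path,
  a leaf of degree 0, does not enter the product (which would otherwise always vanish).\<close>

definition chi :: "tree \<Rightarrow> nat" where
  "chi t = Max {prod_list (map degree (butlast ts)) | ts. ts \<in> leaf_paths t}"

text \<open>The logarithm in a running time bound, kept away from 0. It differs from the
  binary logarithm only for \<open>x < 2\<close> (so among positive integers only at \<open>x = 1\<close>), where the literal
  bound would be vacuously small, e.g. 0 steps when the forest is a single path.\<close>

definition lg :: "real \<Rightarrow> real" where
  "lg x = max 1 (log 2 x)"


section \<open>Model of computation\<close>

text \<open>Programs are written in a first-order functional language over words and pointers to
  immutable pairs. There are no closures, and a program is a fixed finite list of function bodies,
  so each evaluation step is a constant amount of work on a random access machine. The only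
  primitives are word operations, allocation and inspection of one pair, branching, binding and
  calls; comparisons apply to words only.\<close>

datatype val = Num nat | Pair val val

datatype arith = Add | Sub | Mul | Div | Less | Equal

datatype exp =
    Var nat
  | Const nat
  | Arith arith exp exp
  | Cons exp exp
  | Fst exp
  | Snd exp
  | IsPair exp
  | If exp exp exp
  | Let exp exp
  | Call nat exp

type_synonym prog = "exp list"

fun arith_op :: "arith \<Rightarrow> nat \<Rightarrow> nat \<Rightarrow> nat" where
  "arith_op Add x y = x + y"
| "arith_op Sub x y = x - y"
| "arith_op Mul x y = x * y"
| "arith_op Div x y = x div y"
| "arith_op Less x y = (if x < y then 1 else 0)"
| "arith_op Equal x y = (if x = y then 1 else 0)"

text \<open>\<open>eval W P env e v t\<close>: in environment \<open>env\<close> (variables are de Bruijn indices), expression \<open>e\<close>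
  of program \<open>P\<close> evaluates to \<open>v\<close> in \<open>t\<close> steps. Words are the numbers below \<open>W\<close>; an operation
  whose result is not a word has no value, so evaluation gets stuck on overflow. A function body
  sees nothing but its argument.\<close>

inductive eval :: "nat \<Rightarrow> prog \<Rightarrow> val list \<Rightarrow> exp \<Rightarrow> val \<Rightarrow> nat \<Rightarrow> bool" for W P where
  Var: "i < length env \<Longrightarrow> eval W P env (Var i) (env ! i) 1"
| Const: "n < W \<Longrightarrow> eval W P env (Const n) (Num n) 1"
| Arith: "\<lbrakk>eval W P env e1 (Num x) s; eval W P env e2 (Num y) t; arith_op f x y < W\<rbrakk>
    \<Longrightarrow> eval W P env (Arith f e1 e2) (Num (arith_op f x y)) (s + t + 1)"
| Cons: "\<lbrakk>eval W P env e1 u s; eval W P env e2 v t\<rbrakk>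
    \<Longrightarrow> eval W P env (Cons e1 e2) (Pair u v) (s + t + 1)"
| Fst: "eval W P env e (Pair u v) t \<Longrightarrow> eval W P env (Fst e) u (t + 1)"
| Snd: "eval W P env e (Pair u v) t \<Longrightarrow> eval W P env (Snd e) v (t + 1)"
| IsPairTrue: "\<lbrakk>eval W P env e (Pair u v) t; 1 < W\<rbrakk> \<Longrightarrow> eval W P env (IsPair e) (Num 1) (t + 1)"
| IsPairFalse: "eval W P env e (Num n) t \<Longrightarrow> eval W P env (IsPair e) (Num 0) (t + 1)"
| IfTrue: "\<lbrakk>eval W P env e (Num n) s; n \<noteq> 0; eval W P env e1 v t\<rbrakk>
    \<Longrightarrow> eval W P env (If e e1 e2) v (s + t + 1)"
| IfFalse: "\<lbrakk>eval W P env e (Num 0) s; eval W P env e2 v t\<rbrakk>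
    \<Longrightarrow> eval W P env (If e e1 e2) v (s + t + 1)"
| Let: "\<lbrakk>eval W P env e u s; eval W P (u # env) e' v t\<rbrakk>
    \<Longrightarrow> eval W P env (Let e e') v (s + t + 1)"
| Call: "\<lbrakk>f < length P; eval W P env e u s; eval W P [u] (P ! f) v t\<rbrakk>
    \<Longrightarrow> eval W P env (Call f e) v (s + t + 1)"

lemma eval_deterministic:
  assumes "eval W P env e v t" and "eval W P env e v' t'"
  shows "v = v' \<and> t = t'"
  using assms
proof (induction arbitrary: v' t' rule: eval.induct)
  case (IsPairTrue env e u v t)
  from IsPairTrue.prems show ?case
    by cases (use IsPairTrue.IH in blast)+
next
  case (IfTrue env e n s e1 v t e2)
  from IfTrue.prems show ?case
    by cases (use IfTrue.IH IfTrue.hyps in blast)+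
qed (erule eval.cases; blast)+

text \<open>The first function of a program is its entry point.\<close>

definition computes :: "nat \<Rightarrow> prog \<Rightarrow> val \<Rightarrow> val \<Rightarrow> nat \<Rightarrow> bool" where
  "computes W P input result t \<longleftrightarrow> eval W P [input] (Call 0 (Var 0)) result t"

text \<open>The number of cells of a value plus the sum of the numbers in it. It is polynomially related
  to (number of cells) + (largest number). Words below a fixed power of it thus have a number of
  bits logarithmic in the input length and the input numbers, as usual for a word RAM.\<close>

fun magnitude :: "val \<Rightarrow> nat" where
  "magnitude (Num n) = n + 1"
| "magnitude (Pair u v) = magnitude u + magnitude v + 1"

fun enc_list :: "val list \<Rightarrow> val" where
  "enc_list [] = Num 0"
| "enc_list (v # vs) = Pair v (enc_list vs)"

fun enc_tree :: "(nat \<Rightarrow> nat) \<Rightarrow> (nat \<Rightarrow> nat) \<Rightarrow> tree \<Rightarrow> val" where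
  "enc_tree c p (Node j ts) =
     Pair (Num j) (Pair (Num (c j)) (Pair (Num (p j)) (enc_list (map (enc_tree c p) ts))))"

definition enc_input ::
  "nat \<Rightarrow> nat \<Rightarrow> tree list \<Rightarrow> (nat \<Rightarrow> nat) \<Rightarrow> (nat \<Rightarrow> nat) \<Rightarrow> nat \<Rightarrow> val" where
  "enc_input a b Js c p C =
     Pair (Num a) (Pair (Num b) (Pair (Num C) (enc_list (map (enc_tree c p) Js))))"

text \<open>A real \<open>\<epsilon>\<close> is passed to a program as a fraction \<open>a / b\<close> that underestimates it by at most a
  factor of two. Every positive real has such fractions; a rational \<open>\<epsilon>\<close> may be given exactly.\<close>

definition given_by_fraction :: "real \<Rightarrow> nat \<Rightarrow> nat \<Rightarrow> bool" where
  "given_by_fraction \<epsilon> a b \<longleftrightarrow> 0 < b \<and> \<epsilon> / 2 \<le> real a / real b \<and> real a / real b \<le> \<epsilon>"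

end

theory Submission
  imports Defs
begin

text \<open>The children of every node, and the trees of the forest, are combined by balanced binary
  joins. A node of degree \<open>d\<close> contributes at most \<open>2 log\<^sub>2 d\<close> to the nesting depth \<open>D\<close> of joins,
  and a node of degree 1 contributes nothing, so \<open>D \<le> 2 log\<^sub>2 \<chi>(J\<^sub>0)\<close>.

  Dynamic programming over this binary tree stores, for each threshold \<open>T\<close> on a geometric scale of
  ratio \<open>1 + 1/m\<close>, the smallest size found of a selection with profit at least \<open>T\<close>. Profits are rounded
  down once when a single node is offered and once per join, hence a factor of at most
  \<open>(1 + 1/m)\<^bsup>D+1\<^esup> \<le> 1 + \<epsilon>\<close> is lost for \<open>m\<close> of order \<open>(D + 1)/\<epsilon>\<close>. There are \<open>O(m log a\<^sub>0)\<close>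
  thresholds, and joining two tables takes quadratic time: a fixed entry of the first table is
  combined with all of the second in one simultaneous sweep, as both the sums and
  the thresholds increase.

  The scale \<open>T' = T + max 1 \<lfloor>T/m\<rfloor>\<close> stays within the integers: rounding down to it is exact below
  \<open>2 m\<close> and loses a factor of at most \<open>1 + 1/m\<close> above.\<close>


section \<open>Reduction to a binary tree\<close>

text \<open>A forest made binary: \<open>Join\<close> combines selections from two disjoint parts,
  and \<open>Sel j e\<close> is the choice between the single node \<open>j\<close> and a selection
  among its descendants. Joining and choosing are kept apart because only joins count towards the
  depth.\<close>

datatype ctree = Bot | Join ctree ctree | Sel nat ctree

text \<open>One round of a tournament; an odd last element moves on unchanged.\<close>

fun pair_up :: "ctree list \<Rightarrow> ctree list" where
  "pair_up (x # y # xs) = Join x y # pair_up xs"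
| "pair_up xs = xs"

lemma length_pair_up: "length (pair_up xs) = (length xs + 1) div 2"
  by (induction xs rule: pair_up.induct) auto

text \<open>The rounds halve the list, so both the depth is logarithmic and the total work linear in
  the degree. A single element stays unwrapped, which is why nodes of degree 1 cost no join.\<close>

function balance :: "ctree list \<Rightarrow> ctree" where
  "balance [] = Bot"
| "balance [x] = x"
| "balance (x # y # xs) = balance (pair_up (x # y # xs))"
  by pat_completeness auto
termination
  by (relation "measure length") (auto simp: length_pair_up)

fun conv :: "tree \<Rightarrow> ctree" where
  "conv (Node j ts) = Sel j (balance (map conv ts))"

lemma forest_nodes_Nil [simp]: "forest_nodes [] = []"
  by (simp add: forest_nodes_def)

lemma forest_nodes_Cons: "forest_nodes (t # ts) = tree_nodes t @ forest_nodes ts"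
  by (simp add: forest_nodes_def)

lemma tree_nodes_Node: "tree_nodes (Node j ts) = j # forest_nodes ts"
  by (simp add: forest_nodes_def)

declare tree_nodes.simps [simp del] tree_nodes_Node [simp] forest_nodes_Cons [simp]

text \<open>Left-child right-sibling induction: the children \<open>us\<close> of the first root and
  the remaining trees \<open>ts\<close> both have fewer nodes. It replaces nested induction over
  trees and lists of trees.\<close>

lemma forest_induct [case_names Nil Cons]:
  assumes "Q []" and "\<And>j us ts. Q us \<Longrightarrow> Q ts \<Longrightarrow> Q (Node j us # ts)"
  shows "Q ts"
proof (induction "length (forest_nodes ts)" arbitrary: ts rule: less_induct)
  case less
  show ?case
  proof (cases ts)
    case (Cons t us)
    then show ?thesis using assms(2) less by (cases t) auto
  qed (simp add: assms(1))
qed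

fun cnodes :: "ctree \<Rightarrow> nat list" where
  "cnodes Bot = []"
| "cnodes (Join l r) = cnodes l @ cnodes r"
| "cnodes (Sel j e) = j # cnodes e"

lemma cnodes_pair_up: "concat (map cnodes (pair_up xs)) = concat (map cnodes xs)"
  by (induction xs rule: pair_up.induct) auto

lemma cnodes_balance: "cnodes (balance xs) = concat (map cnodes xs)"
proof (induction xs rule: balance.induct)
  case (3 x y xs)
  then show ?case using cnodes_pair_up[of "x # y # xs"] by simp
qed auto

lemma cnodes_convs: "concat (map (cnodes \<circ> conv) ts) = forest_nodes ts"
  by (induction ts rule: forest_induct) (auto simp: cnodes_balance comp_def)

lemma cnodes_balance_conv: "cnodes (balance (map conv ts)) = forest_nodes ts"
  using cnodes_convs[of ts] by (simp add: cnodes_balance)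

fun csize :: "ctree \<Rightarrow> nat" where
  "csize Bot = 1"
| "csize (Join l r) = csize l + csize r + 1"
| "csize (Sel j e) = csize e + 1"

text \<open>Each new \<open>Join\<close> adds one to the size and shortens the list by one.\<close>

lemma csize_pair_up:
  "sum_list (map csize (pair_up xs)) + length (pair_up xs) = sum_list (map csize xs) + length xs"
  by (induction xs rule: pair_up.induct) auto

lemma csize_balance: "csize (balance xs) \<le> sum_list (map csize xs) + length xs + 1"
proof (induction xs rule: balance.induct)
  case (3 x y xs)
  then show ?case using csize_pair_up[of "x # y # xs"] by simp
qed auto

text \<open>Each node pays three units: its \<open>Sel\<close>, its slot among its siblings, and the
  extra unit in \<open>csize_balance\<close>, which covers a \<open>Bot\<close> below a leaf.
  Keeping \<open>length ts\<close> on the left makes the induction close.\<close>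

lemma csize_convs: "sum_list (map (csize \<circ> conv) ts) + length ts \<le> 3 * length (forest_nodes ts)"
proof (induction ts rule: forest_induct)
  case (Cons j us ts)
  then show ?case using csize_balance[of "map conv us"] by (simp add: comp_def)
qed simp

lemma csize_balance_conv: "csize (balance (map conv ts)) \<le> 3 * length (forest_nodes ts) + 1"
  using csize_balance[of "map conv ts"] csize_convs[of ts] by simp


section \<open>Selections\<close>

definition unions :: "'a set set \<Rightarrow> 'a set set \<Rightarrow> 'a set set" where
  "unions A B = {a \<union> b |a b. a \<in> A \<and> b \<in> B}"

lemma unions_empty [simp]: "unions A {{}} = A"
  by (simp add: unions_def)

lemma unions_assoc: "unions (unions A B) C = unions A (unions B C)"
  unfolding unions_def by (auto simp: Un_assoc) (metis Un_assoc)+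

fun sels :: "ctree \<Rightarrow> nat set set" where
  "sels Bot = {{}}"
| "sels (Join l r) = unions (sels l) (sels r)"
| "sels (Sel j e) = insert {j} (sels e)"

text \<open>Pairing neighbours only re-brackets an associative operation.\<close>

lemma sels_pair_up: "foldr unions (map sels (pair_up xs)) {{}} = foldr unions (map sels xs) {{}}"
  by (induction xs rule: pair_up.induct) (auto simp: unions_assoc)

lemma sels_balance: "sels (balance xs) = foldr unions (map sels xs) {{}}"
proof (induction xs rule: balance.induct)
  case (3 x y xs)
  then show ?case using sels_pair_up[of "x # y # xs"] by simp
qed auto

definition indep :: "tree list \<Rightarrow> nat set \<Rightarrow> bool" where
  "indep Js S \<longleftrightarrow> S \<subseteq> set (forest_nodes Js) \<and> disjoint_family_on (rooted_subtree Js) S"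

section \<open>Rooted subtrees and independent selections in a forest\<close>

lemma subtree_nodes: "s \<in> subtrees t \<Longrightarrow> root s \<in> set (tree_nodes s) \<and> set (tree_nodes s) \<subseteq> set (tree_nodes t)"
proof (induction t arbitrary: s)
  case (Node j ts)
  then show ?case by (cases s) (fastforce simp: forest_nodes_def)
qed

lemma forest_subtree_nodes:
  "s \<in> forest_subtrees ts \<Longrightarrow> root s \<in> set (tree_nodes s) \<and> set (tree_nodes s) \<subseteq> set (forest_nodes ts)"
  unfolding forest_subtrees_def forest_nodes_def using subtree_nodes by fastforce

lemma rooted_subtree_subset: "rooted_subtree ts i \<subseteq> set (forest_nodes ts)"
  unfolding rooted_subtree_def using forest_subtree_nodes by blast

lemma rooted_subtree_outside: "i \<notin> set (forest_nodes ts) \<Longrightarrow> rooted_subtree ts i = {}"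
  unfolding rooted_subtree_def using forest_subtree_nodes by blast

lemma mem_forest_root: "i \<in> set (forest_nodes ts) \<Longrightarrow> \<exists>s\<in>forest_subtrees ts. root s = i"
proof (induction ts rule: forest_induct)
  case (Cons j us ts)
  then show ?case
    by (auto simp: forest_subtrees_def)
qed simp

lemma mem_rooted_subtree: "i \<in> set (forest_nodes ts) \<Longrightarrow> i \<in> rooted_subtree ts i"
  unfolding rooted_subtree_def using mem_forest_root forest_subtree_nodes by blast

lemma rooted_subtree_append: "rooted_subtree (ts @ us) i = rooted_subtree ts i \<union> rooted_subtree us i"
  by (auto simp: rooted_subtree_def forest_subtrees_def)

lemma rooted_subtree_Node:
  "rooted_subtree [Node j ts] i =
     (if i = j then insert j (set (forest_nodes ts)) else {}) \<union> rooted_subtree ts i"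
proof -
  have "{t \<in> forest_subtrees [Node j ts]. root t = i} =
      (if i = j then {Node j ts} else {}) \<union> {t \<in> forest_subtrees ts. root t = i}"
    by (auto simp: forest_subtrees_def)
  then show ?thesis
    by (simp add: rooted_subtree_def)
qed

lemma disjoint_family_on_cong:
  assumes "\<And>i. i \<in> S \<Longrightarrow> f i = g i"
  shows "disjoint_family_on f S \<longleftrightarrow> disjoint_family_on g S"
  using assms by (auto simp: disjoint_family_on_def)

text \<open>Distinct names keep the nodes of \<open>t\<close> and of \<open>ts\<close> apart, and a
  rooted subtree stays inside its own tree. Hence overlaps arise only within one of the two parts,
  and a selection can be cut along them.\<close>

lemma indep_Cons:
  assumes "distinct (forest_nodes (t # ts))"
  shows "indep (t # ts) S \<longleftrightarrow> (\<exists>A B. S = A \<union> B \<and> indep [t] A \<and> indep ts B)"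
proof -
  let ?V = "set (forest_nodes [t])" and ?U = "set (forest_nodes ts)"
  have nodes: "set (forest_nodes (t # ts)) = ?V \<union> ?U" and disj: "?V \<inter> ?U = {}"
    using assms by (auto simp: forest_nodes_def)
  have sub: "rooted_subtree (t # ts) i = rooted_subtree [t] i \<union> rooted_subtree ts i" for i
    using rooted_subtree_append[of "[t]" ts] by simp
  have V: "rooted_subtree (t # ts) i = rooted_subtree [t] i" if "i \<in> ?V" for i
    using sub that disj rooted_subtree_outside[of i ts] by auto
  have U: "rooted_subtree (t # ts) i = rooted_subtree ts i" if "i \<in> ?U" for i
    using sub that disj rooted_subtree_outside[of i "[t]"] by auto
  show ?thesis
  proof
    assume S: "indep (t # ts) S"
    have "indep [t] (S \<inter> ?V)" "indep ts (S \<inter> ?U)"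
      using S V U disjoint_family_on_cong[of "S \<inter> ?V" "rooted_subtree (t # ts)" "rooted_subtree [t]"]
        disjoint_family_on_cong[of "S \<inter> ?U" "rooted_subtree (t # ts)" "rooted_subtree ts"]
      by (auto simp: indep_def intro: disjoint_family_on_mono[of _ S])
    moreover have "S = (S \<inter> ?V) \<union> (S \<inter> ?U)"
      using S nodes by (auto simp: indep_def)
    ultimately show "\<exists>A B. S = A \<union> B \<and> indep [t] A \<and> indep ts B" by blast
  next
    assume "\<exists>A B. S = A \<union> B \<and> indep [t] A \<and> indep ts B"
    then obtain A B where S: "S = A \<union> B" and A: "indep [t] A" and B: "indep ts B" by blast
    have eqA: "rooted_subtree (t # ts) i = rooted_subtree [t] i" if "i \<in> A" for i
      using V that A by (auto simp: indep_def)
    have eqB: "rooted_subtree (t # ts) i = rooted_subtree ts i" if "i \<in> B" for i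
      using U that B by (auto simp: indep_def)
    have "disjoint_family_on (rooted_subtree (t # ts)) (A \<union> B)"
      unfolding disjoint_family_on_def
    proof (intro ballI impI)
      fix i k assume ik: "i \<in> A \<union> B" "k \<in> A \<union> B" "i \<noteq> k"
      have *: "rooted_subtree [t] x \<inter> rooted_subtree ts y = {}" for x y
        using rooted_subtree_subset[of "[t]" x] rooted_subtree_subset[of ts y] disj by blast
      have "rooted_subtree [t] i \<inter> rooted_subtree [t] k = {}" if "i \<in> A" "k \<in> A"
        using A that ik by (auto simp: indep_def disjoint_family_on_def)
      moreover have "rooted_subtree ts i \<inter> rooted_subtree ts k = {}" if "i \<in> B" "k \<in> B"
        using B that ik by (auto simp: indep_def disjoint_family_on_def)
      ultimately show "rooted_subtree (t # ts) i \<inter> rooted_subtree (t # ts) k = {}"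
        using ik eqA eqB * by (metis UnE inf_commute)
    qed
    then show "indep (t # ts) S"
      using S A B nodes by (auto simp: indep_def)
  qed
qed

text \<open>The subtree at the root \<open>j\<close> contains every other node, so \<open>j\<close>
  can only be selected alone. Without \<open>j\<close>, the rooted subtrees are the same as in the
  forest \<open>ts\<close>.\<close>

lemma indep_Node:
  assumes "distinct (forest_nodes [Node j ts])"
  shows "indep [Node j ts] S \<longleftrightarrow> S = {j} \<or> indep ts S"
proof -
  have j: "j \<notin> set (forest_nodes ts)"
    using assms by simp
  have nodes: "set (forest_nodes [Node j ts]) = insert j (set (forest_nodes ts))"
    by simp
  have eq: "disjoint_family_on (rooted_subtree [Node j ts]) S \<longleftrightarrow> disjoint_family_on (rooted_subtree ts) S"
    if "j \<notin> S"
    using that by (intro disjoint_family_on_cong) (auto simp: rooted_subtree_Node)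
  show ?thesis
  proof (cases "j \<in> S")
    case True
    have "S = {j}" if S: "indep [Node j ts] S"
    proof (rule ccontr)
      assume "S \<noteq> {j}"
      then obtain i where i: "i \<in> S" "i \<noteq> j" using True by blast
      then have "i \<in> set (forest_nodes ts)" using S nodes by (auto simp: indep_def)
      then have "i \<in> rooted_subtree [Node j ts] i \<inter> rooted_subtree [Node j ts] j"
        using mem_rooted_subtree[of i ts] by (auto simp: rooted_subtree_Node)
      then show False using S i True by (auto simp: indep_def disjoint_family_on_def)
    qed
    then show ?thesis using True j nodes by (auto simp: indep_def disjoint_family_on_def)
  next
    case False
    then show ?thesis using eq nodes by (auto simp: indep_def)
  qed
qed

text \<open>This justifies the reduction: the binary tree offers exactly the non-overlapping
  selections, before the size limit is imposed.\<close>

lemma indep_iff_sels: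
  "distinct (forest_nodes ts) \<Longrightarrow> Collect (indep ts) = sels (balance (map conv ts))"
proof (induction ts rule: forest_induct)
  case Nil
  show ?case by (auto simp: indep_def disjoint_family_on_def)
next
  case (Cons j us ts)
  have d: "distinct (forest_nodes us)" "distinct (forest_nodes ts)" "distinct (forest_nodes [Node j us])"
    using Cons.prems by auto
  have "Collect (indep (Node j us # ts)) = unions (Collect (indep [Node j us])) (Collect (indep ts))"
    using indep_Cons[OF Cons.prems] by (auto simp: unions_def)
  also have "Collect (indep [Node j us]) = insert {j} (Collect (indep us))"
    using indep_Node[OF d(3)] by auto
  finally show ?case
    using Cons.IH d by (simp add: sels_balance)
qed


section \<open>Depth\<close>

text \<open>Only joins are counted, since passing through a \<open>Sel\<close> from below loses no
  profit.\<close>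

fun jdepth :: "ctree \<Rightarrow> nat" where
  "jdepth Bot = 0"
| "jdepth (Join l r) = max (jdepth l) (jdepth r) + 1"
| "jdepth (Sel j e) = jdepth e"

lemma jdepth_le_length: "jdepth e + 1 \<le> csize e"
  by (induction e) auto

lemma jdepth_pair_up:
  "\<forall>x\<in>set xs. jdepth x \<le> h \<Longrightarrow> x \<in> set (pair_up xs) \<Longrightarrow> jdepth x \<le> h + 1"
  by (induction xs rule: pair_up.induct) auto

text \<open>Halving with rounding up shrinks \<open>d\<close> by at least the factor sqrt 2: (d +
  1)^2 \<le> 2 d^2 holds from d = 3 on, and d = 2 is checked directly. At d = 1 the claim
  fails.\<close>

lemma half_square:
  fixes l d :: nat
  assumes "2 * l \<le> d + 1" and "2 \<le> d"
  shows "2 * l ^ 2 \<le> d ^ 2"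
proof (cases "d = 2")
  case True
  then have "l = 0 \<or> l = 1" using assms by auto
  then show ?thesis using True by auto
next
  case False
  define h where "h = d - 3"
  have d: "d = h + 3" using False assms by (simp add: h_def)
  have "(2 * l) ^ 2 \<le> (h + 4) ^ 2" using assms d by (intro power_mono) auto
  also have "\<dots> \<le> 2 * d ^ 2" by (simp add: d power2_eq_square algebra_simps)
  finally show ?thesis by (simp add: power_mult_distrib)
qed

text \<open>The potential \<open>2 ^ h * length xs ^ 2\<close> does not grow in a round:
  \<open>h\<close> increases by one, and by \<open>half_square\<close> the squared length is at
  least halved. With one element left it equals \<open>2 ^ h\<close>.\<close>

lemma jdepth_balance:
  assumes "xs \<noteq> []" and "\<forall>x\<in>set xs. jdepth x \<le> h"
  shows "2 ^ jdepth (balance xs) \<le> 2 ^ h * length xs ^ 2"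
  using assms
proof (induction xs arbitrary: h rule: balance.induct)
  case (2 x)
  then show ?case by simp
next
  case (3 x y xs)
  have "2 ^ jdepth (balance (pair_up (x # y # xs))) \<le>
      2 ^ (h + 1) * length (pair_up (x # y # xs)) ^ 2"
    using "3.prems" jdepth_pair_up[of "x # y # xs" h] by (intro "3.IH") auto
  also have "\<dots> = 2 ^ h * (2 * length (pair_up (x # y # xs)) ^ 2)"
    by (simp only: power_add power_one_right mult.assoc)
  also have "\<dots> \<le> 2 ^ h * length (x # y # xs) ^ 2"
  proof (rule mult_le_mono2)
    show "2 * length (pair_up (x # y # xs)) ^ 2 \<le> length (x # y # xs) ^ 2"
    proof (rule half_square)
      show "2 * length (pair_up (x # y # xs)) \<le> length (x # y # xs) + 1"
        unfolding length_pair_up by linarith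
    qed simp
  qed
  finally show ?case by (simp only: balance.simps)
qed simp

lemma finite_leaf_paths: "finite (leaf_paths t)"
  by (induction t) auto

lemma leaf_paths_not_Nil: "q \<in> leaf_paths t \<Longrightarrow> q \<noteq> []"
  by (cases t) (auto split: if_splits)

lemma jdepth_conv:
  "\<exists>q\<in>leaf_paths t. 2 ^ jdepth (conv t) \<le> prod_list (map degree (butlast q)) ^ 2"
proof (induction t)
  case (Node j ts)
  show ?case
  proof (cases "ts = []")
    case False
    \<comment> \<open>The path descends to a child of greatest join depth; the joins over the
      children are paid for by the square of their number.\<close>
    obtain t where t: "t \<in> set ts" and mx: "\<forall>u\<in>set ts. jdepth (conv u) \<le> jdepth (conv t)"
      using False Max_in[of "(jdepth \<circ> conv) ` set ts"] Max_ge[of "(jdepth \<circ> conv) ` set ts"] by fastforce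
    obtain q where q: "q \<in> leaf_paths t" "2 ^ jdepth (conv t) \<le> prod_list (map degree (butlast q)) ^ 2"
      using Node t by blast
    have "2 ^ jdepth (balance (map conv ts)) \<le> 2 ^ jdepth (conv t) * length (map conv ts) ^ 2"
      using False mx by (intro jdepth_balance) auto
    also have "\<dots> \<le> prod_list (map degree (butlast q)) ^ 2 * length ts ^ 2"
      using q by simp
    finally have "2 ^ jdepth (conv (Node j ts)) \<le> (length ts * prod_list (map degree (butlast q))) ^ 2"
      by (simp add: power_mult_distrib mult.commute)
    moreover have "Node j ts # q \<in> leaf_paths (Node j ts)"
      using False t q by auto
    ultimately show ?thesis
      using leaf_paths_not_Nil[OF q(1)] by (intro bexI[of _ "Node j ts # q"]) (auto simp: degree_def[of "Node _ _"])
  qed simp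
qed

text \<open>The added root \<open>r\<close> turns into one \<open>Sel\<close>, which leaves the join
  depth unchanged.\<close>

lemma jdepth_le_chi: "2 ^ jdepth (balance (map conv ts)) \<le> chi (Node r ts) ^ 2"
proof -
  obtain q where q: "q \<in> leaf_paths (Node r ts)"
    "2 ^ jdepth (conv (Node r ts)) \<le> prod_list (map degree (butlast q)) ^ 2"
    using jdepth_conv by blast
  have "prod_list (map degree (butlast q)) \<le> chi (Node r ts)"
    unfolding chi_def using q finite_leaf_paths by (intro Max_ge) (auto simp: Setcompr_eq_image)
  then have "prod_list (map degree (butlast q)) ^ 2 \<le> chi (Node r ts) ^ 2"
    by (rule power_mono) simp
  with q(2) have "2 ^ jdepth (conv (Node r ts)) \<le> chi (Node r ts) ^ 2" by (rule order_trans)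
  then show ?thesis by simp
qed

lemma jdepth_le_lg: "real (jdepth (balance (map conv ts))) \<le> 2 * lg (real (chi (Node r ts)))"
proof -
  let ?d = "jdepth (balance (map conv ts))" and ?x = "chi (Node r ts)"
  have le: "(2::nat) ^ ?d \<le> ?x ^ 2" by (rule jdepth_le_chi)
  \<comment> \<open>A positive power of two lies below the square, so the logarithm may be taken;
    the square becomes the factor 2.\<close>
  then have pos: "0 < ?x"
    by (metis bot_nat_0.not_eq_extremum le_zero_eq not_numeral_le_zero power_eq_0_iff zero_power2)
  have "real ?d = log 2 (2 ^ ?d)" by simp
  also have "\<dots> \<le> log 2 (real ?x ^ 2)"
    using le pos by (subst log_le_cancel_iff) (auto simp flip: of_nat_power)
  also have "\<dots> = 2 * log 2 (real ?x)" using pos by (simp add: log_nat_power)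
  also have "\<dots> \<le> 2 * lg (real ?x)" by (simp add: lg_def)
  finally show ?thesis .
qed


section \<open>Evaluating programs\<close>

definition fcall :: "nat \<Rightarrow> prog \<Rightarrow> nat \<Rightarrow> val \<Rightarrow> (val \<times> nat) option" where
  "fcall W P f v =
     (if f < length P \<and> (\<exists>rt. eval W P [v] (P ! f) (fst rt) (snd rt))
      then Some (THE rt. eval W P [v] (P ! f) (fst rt) (snd rt)) else None)"

text \<open>Determinism of \<open>eval\<close> makes the pair picked by \<open>THE\<close> unique,
  so that a call can be treated as a partial function returning the result and the number of
  steps.\<close>

lemma fcall_eq_Some: "fcall W P f v = Some (r, t) \<longleftrightarrow> f < length P \<and> eval W P [v] (P ! f) r t"
proof -
  let ?Q = "\<lambda>rt. eval W P [v] (P ! f) (fst rt) (snd rt)"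
  have the: "(THE rt. ?Q rt) = x" if "?Q x" for x
    by (rule the_equality[where P = ?Q, OF that]) (meson eval_deterministic prod_eqI that)
  show ?thesis
  proof (cases "f < length P \<and> (\<exists>x. ?Q x)")
    case True
    then obtain x where x: "?Q x" by blast
    have call: "fcall W P f v = Some x"
      unfolding fcall_def if_P[OF True] the[OF x] by (rule refl)
    show ?thesis
    proof
      assume "fcall W P f v = Some (r, t)"
      then have "x = (r, t)" using call by simp
      then show "f < length P \<and> eval W P [v] (P ! f) r t" using True x by simp
    next
      assume "f < length P \<and> eval W P [v] (P ! f) r t"
      then have "r = fst x \<and> t = snd x" using x eval_deterministic by blast
      then show "fcall W P f v = Some (r, t)" using call by simp
    qed
  next
    case False
    have "fcall W P f v = None"
      unfolding fcall_def if_not_P[OF False] by (rule refl)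
    moreover have "\<not> (f < length P \<and> eval W P [v] (P ! f) r t)"
      using False by (metis fst_conv snd_conv)
    ultimately show ?thesis by simp
  qed
qed

text \<open>Evaluation as a function, recursive in the expression only: calls are answered by \<open>fcall\<close>.
  Rewriting with it executes a function body symbolically, given the results of its calls.\<close>

fun ex :: "nat \<Rightarrow> prog \<Rightarrow> val list \<Rightarrow> exp \<Rightarrow> (val \<times> nat) option" where
  "ex W P env (Var i) = (if i < length env then Some (env ! i, 1) else None)"
| "ex W P env (Const n) = (if n < W then Some (Num n, 1) else None)"
| "ex W P env (Arith f e1 e2) =
     (case ex W P env e1 of Some (Num x, s) \<Rightarrow>
       (case ex W P env e2 of Some (Num y, t) \<Rightarrow>
         if arith_op f x y < W then Some (Num (arith_op f x y), s + t + 1) else None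
       | _ \<Rightarrow> None) | _ \<Rightarrow> None)"
| "ex W P env (Cons e1 e2) =
     (case ex W P env e1 of Some (u, s) \<Rightarrow>
       (case ex W P env e2 of Some (v, t) \<Rightarrow> Some (Pair u v, s + t + 1) | _ \<Rightarrow> None) | _ \<Rightarrow> None)"
| "ex W P env (Fst e) = (case ex W P env e of Some (Pair u v, t) \<Rightarrow> Some (u, t + 1) | _ \<Rightarrow> None)"
| "ex W P env (Snd e) = (case ex W P env e of Some (Pair u v, t) \<Rightarrow> Some (v, t + 1) | _ \<Rightarrow> None)"
| "ex W P env (IsPair e) =
     (case ex W P env e of Some (Pair u v, t) \<Rightarrow> if 1 < W then Some (Num 1, t + 1) else None
      | Some (Num n, t) \<Rightarrow> Some (Num 0, t + 1) | None \<Rightarrow> None)"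
| "ex W P env (If e e1 e2) =
     (case ex W P env e of Some (Num n, s) \<Rightarrow>
       (case (if n \<noteq> 0 then ex W P env e1 else ex W P env e2) of
          Some (v, t) \<Rightarrow> Some (v, s + t + 1) | None \<Rightarrow> None) | _ \<Rightarrow> None)"
| "ex W P env (Let e e') =
     (case ex W P env e of Some (u, s) \<Rightarrow>
       (case ex W P (u # env) e' of Some (v, t) \<Rightarrow> Some (v, s + t + 1) | _ \<Rightarrow> None) | _ \<Rightarrow> None)"
| "ex W P env (Call f e) =
     (case ex W P env e of Some (u, s) \<Rightarrow>
       (case fcall W P f u of Some (v, t) \<Rightarrow> Some (v, s + t + 1) | _ \<Rightarrow> None) | _ \<Rightarrow> None)"

text \<open>One direction suffices, since terminating runs only have to be exhibited.\<close>

lemma ex_sound: "ex W P env e = Some (v, t) \<Longrightarrow> eval W P env e v t"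
proof (induction e arbitrary: env v t)
  case (Arith f e1 e2)
  from Arith.prems obtain x s y u where a: "ex W P env e1 = Some (Num x, s)"
    and b: "ex W P env e2 = Some (Num y, u)"
    and c: "arith_op f x y < W"
    and eqs: "v = Num (arith_op f x y)" "t = s + u + 1"
    by (auto split: option.splits val.splits prod.splits if_splits)
  show ?case unfolding eqs by (rule eval.Arith[OF Arith.IH(1)[OF a] Arith.IH(2)[OF b] c])
next
  case (Cons e1 e2)
  from Cons.prems obtain x s y u where a: "ex W P env e1 = Some (x, s)"
    and b: "ex W P env e2 = Some (y, u)"
    and eqs: "v = Pair x y" "t = s + u + 1"
    by (auto split: option.splits prod.splits)
  show ?case unfolding eqs by (rule eval.Cons[OF Cons.IH(1)[OF a] Cons.IH(2)[OF b]])
next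
  case (Let e1 e2)
  from Let.prems obtain x s u where a: "ex W P env e1 = Some (x, s)"
    and b: "ex W P (x # env) e2 = Some (v, u)"
    and eqs: "t = s + u + 1"
    by (auto split: option.splits prod.splits)
  show ?case unfolding eqs by (rule eval.Let[OF Let.IH(1)[OF a] Let.IH(2)[OF b]])
next
  case (Call f e)
  from Call.prems obtain x s u where a: "ex W P env e = Some (x, s)"
    and b: "fcall W P f x = Some (v, u)"
    and eqs: "t = s + u + 1"
    by (auto split: option.splits prod.splits)
  show ?case unfolding eqs by (rule eval.Call[OF b[unfolded fcall_eq_Some, THEN conjunct1] Call.IH[OF a] b[unfolded fcall_eq_Some, THEN conjunct2]])
next
  case (Fst e)
  from Fst.prems obtain y u where a: "ex W P env e = Some (Pair v y, u)"
    and eqs: "t = u + 1"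
    by (auto split: option.splits val.splits prod.splits)
  show ?case unfolding eqs by (rule eval.Fst[OF Fst.IH[OF a]])
next
  case (Snd e)
  from Snd.prems obtain y u where a: "ex W P env e = Some (Pair y v, u)"
    and eqs: "t = u + 1"
    by (auto split: option.splits val.splits prod.splits)
  show ?case unfolding eqs by (rule eval.Snd[OF Snd.IH[OF a]])
next
  case (Var i)
  from Var.prems have a: "i < length env"
    and eqs: "v = env ! i" "t = 1"
    by (auto split: if_splits)
  show ?case unfolding eqs by (rule eval.Var[OF a])
next
  case (Const n)
  from Const.prems have a: "n < W"
    and eqs: "v = Num n" "t = 1"
    by (auto split: if_splits)
  show ?case unfolding eqs by (rule eval.Const[OF a])
next
  case (If e e1 e2)
  from If.prems obtain n s where n: "ex W P env e = Some (Num n, s)"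
    by (auto split: option.splits val.splits prod.splits)
  show ?case
  proof (cases "n = 0")
    case True
    with If.prems n obtain u where a: "ex W P env e2 = Some (v, u)" and t: "t = s + u + 1"
      by (auto split: option.splits prod.splits)
    show ?thesis
      unfolding t by (rule eval.IfFalse[OF If.IH(1)[OF n[unfolded True]] If.IH(3)[OF a]])
  next
    case False
    with If.prems n obtain u where a: "ex W P env e1 = Some (v, u)" and t: "t = s + u + 1"
      by (auto split: option.splits prod.splits)
    show ?thesis
      unfolding t by (rule eval.IfTrue[OF If.IH(1)[OF n] False If.IH(2)[OF a]])
  qed
next
  case (IsPair e)
  from IsPair.prems obtain x u where x: "ex W P env e = Some (x, u)" and t: "t = u + 1"
    by (auto split: option.splits val.splits if_splits prod.splits)
  show ?case
  proof (cases x)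
    case (Num n)
    then have v: "v = Num 0" using x IsPair.prems by simp
    show ?thesis
      unfolding t v by (rule eval.IsPairFalse[OF IsPair.IH[OF x[unfolded Num]]])
  next
    case (Pair y z)
    then have W: "1 < W" and v: "v = Num 1" using x IsPair.prems by (auto split: if_splits)
    show ?thesis
      unfolding t v by (rule eval.IsPairTrue[OF IsPair.IH[OF x[unfolded Pair]] W])
  qed
qed

lemma fcallI:
  assumes "f < length P" and "ex W P [v] (P ! f) = Some (r, t)"
  shows "fcall W P f v = Some (r, t)"
  unfolding fcall_eq_Some using assms(1) ex_sound[OF assms(2)] by (rule conjI)


section \<open>Rounded dynamic programming\<close>

text \<open>Selections are kept as unflattened trees, so that joining two of them is one allocation
  with sharing instead of a list concatenation.\<close>

datatype sol = SEmpty | SOne nat | SJoin sol sol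

fun snodes :: "sol \<Rightarrow> nat list" where
  "snodes SEmpty = []"
| "snodes (SOne j) = [j]"
| "snodes (SJoin x y) = snodes x @ snodes y"

fun ssize :: "sol \<Rightarrow> nat" where
  "ssize SEmpty = 1"
| "ssize (SOne j) = 1"
| "ssize (SJoin x y) = ssize x + ssize y + 1"

type_synonym table = "(nat \<times> (nat \<times> sol) option) list"

fun better :: "(nat \<times> sol) option \<Rightarrow> nat \<times> sol \<Rightarrow> (nat \<times> sol) option" where
  "better None x = Some x"
| "better (Some y) x = (if fst x < fst y then Some x else Some y)"

text \<open>One entry with threshold \<open>T\<close> is combined with the whole table
  \<open>es\<close>. The sums \<open>T + U\<close> increase along \<open>es\<close>, so the output
  position in \<open>rs\<close> only moves forward; a candidate is written at the last threshold not
  above its sum.\<close>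

fun row :: "nat \<Rightarrow> nat \<Rightarrow> sol \<Rightarrow> table \<Rightarrow> table \<Rightarrow> table" where
  "row T s x rs [] = rs"
| "row T s x rs ((U, None) # es) = row T s x rs es"
| "row T s x [] ((U, Some sx) # es) = []"
| "row T s x ((V, r) # rs) ((U, Some (s', x')) # es) =
     (if rs \<noteq> [] \<and> fst (hd rs) \<le> T + U then (V, r) # row T s x rs ((U, Some (s', x')) # es)
      else row T s x ((V, better r (s + s', SJoin x x')) # rs) es)"

fun merge :: "table \<Rightarrow> table \<Rightarrow> table \<Rightarrow> table" where
  "merge [] es acc = acc"
| "merge ((T, None) # ts) es acc = merge ts es acc"
| "merge ((T, Some (s, x)) # ts) es acc = merge ts es (row T s x acc es)"

text \<open>The node is offered at every threshold up to its profit, since each of them is a valid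
  lower bound; the scan stops at the first larger one.\<close>

fun ins :: "nat \<Rightarrow> nat \<times> sol \<Rightarrow> table \<Rightarrow> table" where
  "ins q x [] = []"
| "ins q x ((T, e) # tab) = (if q < T then (T, e) # tab else (T, better e x) # ins q x tab)"

fun dp :: "table \<Rightarrow> (nat \<Rightarrow> nat) \<Rightarrow> (nat \<Rightarrow> nat) \<Rightarrow> ctree \<Rightarrow> table" where
  "dp base c p Bot = base"
| "dp base c p (Join l r) = merge (dp base c p l) (dp base c p r) base"
| "dp base c p (Sel j e) = ins (p j) (c j, SOne j) (dp base c p e)"

text \<open>Thresholds increase along the table, so the last entry that fits is the one with the
  highest guaranteed profit.\<close>

fun pick :: "nat \<Rightarrow> table \<Rightarrow> sol \<Rightarrow> sol" where
  "pick C [] best = best"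
| "pick C ((T, None) # tab) best = pick C tab best"
| "pick C ((T, Some (s, x)) # tab) best = pick C tab (if C < s then best else x)"

text \<open>The \<open>max 1\<close> forces progress where \<open>T div m\<close> vanishes,
  including the case \<open>m = 0\<close>.\<close>

function thresholds :: "nat \<Rightarrow> nat \<Rightarrow> nat \<Rightarrow> table" where
  "thresholds P m T = (if P < T then [] else (T, None) # thresholds P m (T + max 1 (T div m)))"
  by pat_completeness auto
termination
  by (relation "measure (\<lambda>(P, m, T). Suc P - T)") auto

declare thresholds.simps [simp del]

text \<open>Threshold 0 with the empty selection is present from the start, so every profit has a
  threshold below it and every join a valid candidate.\<close>

definition base_table :: "nat \<Rightarrow> nat \<Rightarrow> table" where
  "base_table P m = (0, Some (0, SEmpty)) # thresholds P m 1"

section \<open>Invariants of the table operations\<close>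

lemma fst_row [simp]: "map fst (row T s x rs es) = map fst rs"
  by (induction T s x rs es rule: row.induct) auto

lemma fst_merge [simp]: "map fst (merge ts es acc) = map fst acc"
  by (induction ts es acc rule: merge.induct) auto

lemma fst_ins [simp]: "map fst (ins q x tab) = map fst tab"
  by (induction q x tab rule: ins.induct) auto

lemma fst_dp [simp]: "map fst (dp base c p e) = map fst base"
  by (induction e) auto

lemma length_row [simp]: "length (row T s x rs es) = length rs"
  by (metis fst_row length_map)

lemma length_dp [simp]: "length (dp base c p e) = length base"
  by (metis fst_dp length_map)

text \<open>Completeness speaks of sizes at most \<open>k\<close>, because an entry may later be
  replaced by a smaller one.\<close>

definition covers :: "(nat \<times> sol) option \<Rightarrow> nat \<Rightarrow> bool" where
  "covers r k \<longleftrightarrow> (\<exists>s x. r = Some (s, x) \<and> s \<le> k)"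

definition reaches :: "table \<Rightarrow> nat \<Rightarrow> nat \<Rightarrow> bool" where
  "reaches tab T k \<longleftrightarrow> (\<exists>r. (T, r) \<in> set tab \<and> covers r k)"

lemma reaches_Cons [simp]: "reaches ((V, r) # tab) T k \<longleftrightarrow> T = V \<and> covers r k \<or> reaches tab T k"
  by (auto simp: reaches_def)

lemma reaches_Nil [simp]: "\<not> reaches [] T k"
  by (simp add: reaches_def)

lemma covers_better: "covers (better r y) k \<longleftrightarrow> covers r k \<or> fst y \<le> k"
  by (cases r; cases y) (auto simp: covers_def)

definition all_entries :: "(nat \<Rightarrow> nat \<Rightarrow> sol \<Rightarrow> bool) \<Rightarrow> table \<Rightarrow> bool" where
  "all_entries Q tab \<longleftrightarrow> (\<forall>T s x. (T, Some (s, x)) \<in> set tab \<longrightarrow> Q T s x)"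

lemma all_entries_simps [simp]:
  "all_entries Q []"
  "all_entries Q ((T, None) # tab) \<longleftrightarrow> all_entries Q tab"
  "all_entries Q ((T, Some (s, x)) # tab) \<longleftrightarrow> Q T s x \<and> all_entries Q tab"
  by (auto simp: all_entries_def)

lemma all_entries_better:
  "all_entries Q ((T, r) # tab) \<Longrightarrow> Q T (fst y) (snd y) \<Longrightarrow> all_entries Q ((T, better r y) # tab)"
  by (cases r; cases y) (auto split: if_splits)

lemma all_entries_tl: "all_entries Q ((T, r) # tab) \<Longrightarrow> all_entries Q tab"
  by (auto simp: all_entries_def)

lemma all_entries_Cons: "all_entries Q ((T, r) # tab) \<longleftrightarrow> (\<forall>s x. r = Some (s, x) \<longrightarrow> Q T s x) \<and> all_entries Q tab"
  by (auto simp: all_entries_def)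

text \<open>Consecutive thresholds are close: rounding a number up to \<open>P\<close> down to a threshold loses
  a factor of at most \<open>1 + 1/m\<close>.\<close>

fun dense :: "nat \<Rightarrow> nat \<Rightarrow> nat list \<Rightarrow> bool" where
  "dense m P [] \<longleftrightarrow> False"
| "dense m P [T] \<longleftrightarrow> (\<forall>x\<le>P. m * x \<le> (m + 1) * T)"
| "dense m P (T # T' # ts) \<longleftrightarrow> T < T' \<and> (\<forall>x<T'. m * x \<le> (m + 1) * T) \<and> dense m P (T' # ts)"

lemma dense_sorted: "dense m P ts \<Longrightarrow> sorted ts"
  by (induction ts rule: induct_list012) auto

lemma dense_tl: "dense m P (T # ts) \<Longrightarrow> ts \<noteq> [] \<Longrightarrow> dense m P ts"
  by (cases ts) auto

text \<open>The situation in which a sweep stops: \<open>x\<close> lies below the next threshold, or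
  there is none.\<close>

lemma dense_head:
  "dense m P (T # ts) \<Longrightarrow> x \<le> P \<Longrightarrow> ts = [] \<or> x < hd ts \<Longrightarrow> m * x \<le> (m + 1) * T"
  by (cases ts) auto

text \<open>The invariant on \<open>hd rs\<close> says that the output position is never above a sum
  still to come, so a candidate is stored only at thresholds that its profit bound supports.\<close>

lemma row_sound:
  assumes "sorted (map fst es)" and "\<forall>U\<in>fst ` set es. fst (hd rs) \<le> T + U"
    and "all_entries Q rs"
    and "all_entries (\<lambda>U s' x'. \<forall>V\<le>T + U. Q V (s + s') (SJoin x x')) es"
  shows "all_entries Q (row T s x rs es)"
  using assms
proof (induction T s x rs es rule: row.induct)
  case (4 T s x V r rs U s' x' es)
  show ?case
  proof (cases "rs \<noteq> [] \<and> fst (hd rs) \<le> T + U")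
    case True
    \<comment> \<open>Moving forward is safe for all remaining entries because \<open>es\<close> is
      sorted.\<close>
    have hd: "\<forall>W\<in>fst ` set ((U, Some (s', x')) # es). fst (hd rs) \<le> T + W"
    proof
      fix W assume "W \<in> fst ` set ((U, Some (s', x')) # es)"
      then have "U \<le> W" using "4.prems"(1) by auto
      then show "fst (hd rs) \<le> T + W" using True by linarith
    qed
    have "all_entries Q (row T s x rs ((U, Some (s', x')) # es))"
      by (rule "4.IH"(1)[OF True "4.prems"(1) hd all_entries_tl[OF "4.prems"(3)] "4.prems"(4)])
    then show ?thesis using "4.prems"(3) True by (simp add: all_entries_Cons[of Q V])
  next
    case False
    have "all_entries Q ((V, better r (s + s', SJoin x x')) # rs)"
      using "4.prems" by (intro all_entries_better) auto
    then have "all_entries Q (row T s x ((V, better r (s + s', SJoin x x')) # rs) es)"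
      using "4.prems" False by (intro "4.IH"(2)) auto
    then show ?thesis using False by auto
  qed
qed auto

lemma row_mono: "reaches rs V k \<Longrightarrow> reaches (row T s x rs es) V k"
proof (induction T s x rs es rule: row.induct)
  case (4 T s x V' r rs U s' x' es)
  then show ?case by (auto simp: covers_better)
qed auto

text \<open>When the entry at \<open>U\<close> is processed, the sweep has stopped at a threshold
  \<open>V\<close> to which \<open>T + U\<close> rounds down. Later candidates can only lower the
  size stored there, by \<open>row_mono\<close>.\<close>

lemma row_complete:
  assumes "dense m P (map fst rs)" and "(U, Some (s', x')) \<in> set es" and "T + U \<le> P"
  shows "\<exists>V. m * (T + U) \<le> (m + 1) * V \<and> reaches (row T s x rs es) V (s + s')"
  using assms
proof (induction T s x rs es rule: row.induct)
  case (4 T s x V r rs W t y es)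
  show ?case
  proof (cases "rs \<noteq> [] \<and> fst (hd rs) \<le> T + W")
    case True
    have "\<exists>V. m * (T + U) \<le> (m + 1) * V \<and> reaches (row T s x rs ((W, Some (t, y)) # es)) V (s + s')"
      using "4.prems" True dense_tl by (intro "4.IH"(1)) auto
    then show ?thesis using True by auto
  next
    case False
    let ?rs = "(V, better r (s + t, SJoin x y)) # rs"
    show ?thesis
    proof (cases "(U, Some (s', x')) \<in> set es")
      case True
      have "\<exists>V. m * (T + U) \<le> (m + 1) * V \<and> reaches (row T s x ?rs es) V (s + s')"
        using "4.prems" False True by (intro "4.IH"(2)) auto
      then show ?thesis using False by auto
    next
      \<comment> \<open>The entry in question is the current one, so its candidate is written at
        \<open>V\<close>.\<close>
      case here: False
      then have eq: "W = U" "t = s'" using "4.prems" by auto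
      have "m * (T + U) \<le> (m + 1) * V"
        using False "4.prems" eq by (intro dense_head[of m P V "map fst rs"]; cases rs) auto
      moreover have "reaches (row T s x ?rs es) V (s + s')"
        by (rule row_mono) (auto simp: covers_better eq)
      ultimately show ?thesis using False by auto
    qed
  qed
qed auto

text \<open>Every row starts its sweep at threshold 0, which meets the invariant of
  \<open>row_sound\<close>; rows change no thresholds, so this persists.\<close>

lemma merge_sound:
  assumes "sorted (map fst es)" and "fst (hd acc) = 0" and "all_entries Q acc"
    and "all_entries (\<lambda>T s x. all_entries (\<lambda>U s' x'. \<forall>V\<le>T + U. Q V (s + s') (SJoin x x')) es) ts"
    and "acc \<noteq> []"
  shows "all_entries Q (merge ts es acc)"
  using assms
proof (induction ts es acc rule: merge.induct)
  case (3 T s x ts es acc)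
  have ne: "row T s x acc es \<noteq> []"
    using "3.prems"(5) by (metis length_0_conv length_row)
  have hd: "fst (hd (row T s x acc es)) = 0"
    using "3.prems"(2,5) ne by (metis fst_row hd_map)
  have "all_entries Q (row T s x acc es)"
    using "3.prems" by (intro row_sound) auto
  from "3.IH"[OF "3.prems"(1) hd this _ ne] "3.prems"(4) show ?case by simp
qed auto

lemma merge_mono: "reaches acc V k \<Longrightarrow> reaches (merge ts es acc) V k"
  by (induction ts es acc rule: merge.induct) (auto intro: row_mono)

lemma merge_complete:
  assumes "dense m P (map fst acc)" and "(T, Some (s, x)) \<in> set ts"
    and "(U, Some (s', x')) \<in> set es" and "T + U \<le> P"
  shows "\<exists>V. m * (T + U) \<le> (m + 1) * V \<and> reaches (merge ts es acc) V (s + s')"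
  using assms
proof (induction ts es acc rule: merge.induct)
  case (3 T' t y ts es acc)
  show ?case
  proof (cases "(T, Some (s, x)) \<in> set ts")
    case False
    then have "T' = T" "t = s" "y = x" using "3.prems" by auto
    then show ?thesis
      using row_complete[OF "3.prems"(1,3,4), of s x] merge_mono by fastforce
  qed (use 3 in auto)
qed auto

lemma ins_sound:
  assumes "all_entries Q tab" and "\<And>V. V \<le> q \<Longrightarrow> Q V (fst x) (snd x)"
  shows "all_entries Q (ins q x tab)"
  using assms
proof (induction q x tab rule: ins.induct)
  case (2 q x T e tab)
  show ?case
  proof (cases "q < T")
    case False
    have "all_entries Q ((T, better e x) # ins q x tab)"
      using 2 False all_entries_tl
      by (intro all_entries_better) (auto simp: all_entries_Cons[of Q T e])
    then show ?thesis using False by simp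
  qed (use 2 in simp)
qed simp

lemma ins_mono: "reaches tab V k \<Longrightarrow> reaches (ins q x tab) V k"
  by (induction q x tab rule: ins.induct) (auto simp: covers_better)

lemma ins_complete:
  assumes "dense m P (map fst tab)" and "q \<le> P" and "fst (hd tab) \<le> q"
  shows "\<exists>V. m * q \<le> (m + 1) * V \<and> reaches (ins q x tab) V (fst x)"
  using assms
proof (induction q x tab rule: ins.induct)
  case (2 q x T e tab)
  show ?case
  proof (cases "tab \<noteq> [] \<and> fst (hd tab) \<le> q")
    case True
    then show ?thesis using 2 dense_tl by fastforce
  next
    case False
    then have "m * q \<le> (m + 1) * T"
      using 2 by (intro dense_head[of m P T "map fst tab"]; cases tab) auto
    then show ?thesis using 2 by (intro exI[of _ T]) (auto simp: covers_better)
  qed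
qed simp

section \<open>The geometric scale of integer thresholds\<close>

lemma dense_thresholds:
  assumes "0 < m" and "T \<le> P"
  shows "dense m P (map fst (thresholds P m T))"
  using assms(2)
proof (induction P m T rule: thresholds.induct)
  case (1 P m T)
  let ?T = "T + max 1 (T div m)"
  \<comment> \<open>If \<open>T div m\<close> is 0, the step is 1 and nothing lies strictly between
    the thresholds; otherwise \<open>m * (T div m) \<le> T\<close> gives the ratio.\<close>
  have close: "m * x \<le> (m + 1) * T" if "x < ?T" for x
  proof (cases "T div m = 0")
    case True
    then have "m * x \<le> m * T" using that by (intro mult_le_mono2) simp
    also have "\<dots> \<le> (m + 1) * T" by simp
    finally show ?thesis .
  next
    case False
    then have "m * x \<le> m * (T + T div m)" using that by (intro mult_le_mono2) simp
    also have "\<dots> \<le> m * T + T" by (simp add: distrib_left)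
    finally show ?thesis by simp
  qed
  show ?case
  proof (cases "?T \<le> P")
    case True
    then have IH: "dense m P (map fst (thresholds P m ?T))" using 1 by simp
    have T: "map fst (thresholds P m ?T) = ?T # map fst (thresholds P m (?T + max 1 (?T div m)))"
      using True by (subst thresholds.simps) simp
    have "map fst (thresholds P m T) = T # map fst (thresholds P m ?T)"
      using 1(2) by (subst thresholds.simps) simp
    then show ?thesis using IH close unfolding T by simp
  next
    case False
    then have "thresholds P m ?T = []" by (subst thresholds.simps) simp
    then have "map fst (thresholds P m T) = [T]"
      using 1(2) by (subst thresholds.simps) simp
    then show ?thesis using close False by simp
  qed
qed

lemma dense_base_table:
  assumes "0 < m" shows "dense m P (map fst (base_table P m))"
proof (cases "P = 0")
  case True
  then show ?thesis by (simp add: base_table_def thresholds.simps)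
next
  case False
  have "map fst (thresholds P m 1) = 1 # map fst (thresholds P m (1 + max 1 (1 div m)))"
    using False by (subst thresholds.simps) simp
  then show ?thesis using dense_thresholds[OF assms, of 1 P] False by (simp add: base_table_def)
qed

lemma thresholds_entries: "(T', r) \<in> set (thresholds P m T) \<Longrightarrow> T' \<le> P \<and> r = None"
proof (induction P m T rule: thresholds.induct)
  case (1 P m T)
  then show ?case by (subst (asm) (2) thresholds.simps) (auto split: if_splits)
qed

lemma all_entries_base_table: "Q 0 0 SEmpty \<Longrightarrow> all_entries Q (base_table P m)"
  using thresholds_entries by (fastforce simp: base_table_def all_entries_def)

lemma base_table_le: "T \<in> fst ` set (base_table P m) \<Longrightarrow> T \<le> P"
  using thresholds_entries by (fastforce simp: base_table_def)

lemma hd_dp: "fst (hd (dp (base_table P m) c p e)) = 0"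
proof -
  have "map fst (dp (base_table P m) c p e) = 0 # map fst (thresholds P m 1)"
    by (simp add: base_table_def)
  then show ?thesis by (cases "dp (base_table P m) c p e") auto
qed

section \<open>Soundness and completeness of the dynamic program\<close>

lemma sels_subset: "S \<in> sels e \<Longrightarrow> S \<subseteq> set (cnodes e)"
  by (induction e arbitrary: S) (fastforce simp: unions_def)+

lemma empty_in_sels: "{} \<in> sels e"
  by (induction e) (auto simp: unions_def)

text \<open>Sizes are exact, while the threshold is only a lower bound on the profit. The bound on
  \<open>ssize\<close> is carried along for the cost of flattening the result.\<close>

definition represents ::
  "(nat \<Rightarrow> nat) \<Rightarrow> (nat \<Rightarrow> nat) \<Rightarrow> ctree \<Rightarrow> nat \<Rightarrow> nat \<Rightarrow> sol \<Rightarrow> bool" where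
  "represents c p e T s x \<longleftrightarrow> set (snodes x) \<in> sels e \<and> distinct (snodes x) \<and> ssize x \<le> csize e \<and>
     s = sum c (set (snodes x)) \<and> T \<le> sum p (set (snodes x))"

text \<open>Joined selections use disjoint node sets, so sizes and profits add up; rounding a
  threshold down keeps it a lower bound.\<close>

lemma dp_sound:
  assumes "distinct (cnodes e)" and "0 < m"
  shows "all_entries (represents c p e) (dp (base_table P m) c p e)"
  using assms(1)
proof (induction e)
  case Bot
  show ?case by (auto simp: represents_def intro!: all_entries_base_table)
next
  case (Sel j e)
  have "all_entries (represents c p (Sel j e)) (dp (base_table P m) c p e)"
    using Sel by (auto simp: all_entries_def represents_def intro: le_SucI)
  then show ?case
    unfolding dp.simps by (rule ins_sound) (simp add: represents_def)
next
  case (Join l r)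
  have join: "represents c p (Join l r) V (s + s') (SJoin x x')"
    if "represents c p l T s x" "represents c p r U s' x'" "V \<le> T + U" for T s x U s' x' V
  proof -
    have "set (snodes x) \<inter> set (snodes x') = {}"
      using that Join.prems sels_subset unfolding represents_def by fastforce
    then show ?thesis
      using that by (auto simp: represents_def unions_def sum.union_disjoint)
  qed
  have "all_entries (represents c p l) (dp (base_table P m) c p l)"
    "all_entries (represents c p r) (dp (base_table P m) c p r)"
    using Join by auto
  then have "all_entries (\<lambda>T s x. all_entries (\<lambda>U s' x'. \<forall>V\<le>T + U.
      represents c p (Join l r) V (s + s') (SJoin x x')) (dp (base_table P m) c p r))
      (dp (base_table P m) c p l)"
    using join unfolding all_entries_def by blast
  moreover have "sorted (map fst (dp (base_table P m) c p r))"
    using dense_sorted[OF dense_base_table[OF assms(2)]] by simp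
  moreover have "all_entries (represents c p (Join l r)) (base_table P m)"
    using empty_in_sels[of "Join l r"] by (intro all_entries_base_table) (auto simp: represents_def)
  ultimately show ?case
    unfolding dp.simps by (intro merge_sound) (auto simp: base_table_def)
qed

text \<open>The inequality x \<le> (1 + 1/m)^k y, cleared of denominators, weakens as the exponent
  grows. This brings both sides of a join to a common exponent.\<close>

lemma power_ratio_mono:
  fixes m :: nat
  assumes "m ^ k * x \<le> (m + 1) ^ k * y" and "k \<le> l"
  shows "m ^ l * x \<le> (m + 1) ^ l * y"
proof -
  have pow: "z ^ l = z ^ (l - k) * z ^ k" for z :: nat
    using assms(2) by (metis le_add_diff_inverse2 power_add)
  have "m ^ l * x = m ^ (l - k) * (m ^ k * x)"
    by (simp only: pow mult.assoc)
  also have "\<dots> \<le> (m + 1) ^ (l - k) * ((m + 1) ^ k * y)"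
    by (rule mult_le_mono[OF power_mono assms(1)]) auto
  also have "\<dots> = (m + 1) ^ l * y"
    by (simp only: pow mult.assoc)
  finally show ?thesis .
qed

lemma reachesE:
  assumes "reaches tab T k"
  obtains s x where "(T, Some (s, x)) \<in> set tab" and "s \<le> k"
  using assms by (auto simp: reaches_def covers_def)

lemma reaches_mono: "reaches tab T k \<Longrightarrow> k \<le> l \<Longrightarrow> reaches tab T l"
  by (fastforce simp: reaches_def covers_def)

text \<open>The exponent counts one rounding when a node is offered and one for each join above it.
  Sizes are never rounded, so some entry needs at most the exact size of \<open>S\<close>.\<close>

lemma dp_complete:
  assumes "distinct (cnodes e)" and "0 < m" and "sum p (set (cnodes e)) \<le> P" and "S \<in> sels e"
  shows "\<exists>T. m ^ (jdepth e + 1) * sum p S \<le> (m + 1) ^ (jdepth e + 1) * T \<and>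
    reaches (dp (base_table P m) c p e) T (sum c S)"
  using assms(1,3,4)
proof (induction e arbitrary: S)
  case Bot
  then show ?case by (intro exI[of _ 0]) (auto simp: base_table_def covers_def)
next
  case (Sel j e)
  show ?case
  proof (cases "S = {j}")
    case True
    have "\<exists>V. m * p j \<le> (m + 1) * V \<and>
        reaches (ins (p j) (c j, SOne j) (dp (base_table P m) c p e)) V (fst (c j, SOne j))"
      using Sel.prems dense_base_table[OF assms(2)] hd_dp by (intro ins_complete[of m P]) auto
    then obtain V where V: "m ^ 1 * p j \<le> (m + 1) ^ 1 * V"
        "reaches (dp (base_table P m) c p (Sel j e)) V (sum c S)"
      using True by auto
    \<comment> \<open>Offering \<open>j\<close> cost a single rounding; the exponent is raised to
      the one claimed.\<close>
    have "m ^ (jdepth e + 1) * p j \<le> (m + 1) ^ (jdepth e + 1) * V"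
      by (rule power_ratio_mono[OF V(1)]) simp
    then have "m ^ (jdepth e + 1) * sum p S \<le> (m + 1) ^ (jdepth e + 1) * V"
      using True by (simp only: sum.insert[of "{}" j p] sum.empty finite.emptyI empty_iff not_False_eq_True add_0_right)
    then show ?thesis
      unfolding jdepth.simps by (intro exI[of _ V] conjI V(2))
  next
    case False
    have "S \<in> sels e" "distinct (cnodes e)" "sum p (set (cnodes e)) \<le> P"
      using Sel.prems False by auto
    from Sel.IH[OF this(2,3,1)]
    obtain T where "m ^ (jdepth e + 1) * sum p S \<le> (m + 1) ^ (jdepth e + 1) * T"
        and r: "reaches (dp (base_table P m) c p e) T (sum c S)"
      by blast
    then show ?thesis
      unfolding jdepth.simps dp.simps by (intro exI[of _ T] conjI ins_mono[OF r])
  qed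
next
  case (Join l r)
  let ?d = "max (jdepth l) (jdepth r) + 1"
  from Join.prems obtain A B where S: "S = A \<union> B" and A: "A \<in> sels l" and B: "B \<in> sels r"
    by (auto simp: unions_def)
  have AB: "A \<inter> B = {}" "finite A" "finite B"
    using Join.prems sels_subset[OF A] sels_subset[OF B] by (auto intro: finite_subset)
  have nodes: "sum p (set (cnodes (Join l r))) = sum p (set (cnodes l)) + sum p (set (cnodes r))"
    using Join.prems by (simp add: sum.union_disjoint)
  obtain T where T: "m ^ (jdepth l + 1) * sum p A \<le> (m + 1) ^ (jdepth l + 1) * T"
      and rT: "reaches (dp (base_table P m) c p l) T (sum c A)"
    using Join.IH(1)[OF _ _ A] Join.prems(1,2) nodes
    by (metis add_leE cnodes.simps(2) distinct_append)
  obtain U where U: "m ^ (jdepth r + 1) * sum p B \<le> (m + 1) ^ (jdepth r + 1) * U"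
      and rU: "reaches (dp (base_table P m) c p r) U (sum c B)"
    using Join.IH(2)[OF _ _ B] Join.prems(1,2) nodes
    by (metis add_leE cnodes.simps(2) distinct_append)
  obtain s x where s: "(T, Some (s, x)) \<in> set (dp (base_table P m) c p l)" "s \<le> sum c A"
    using rT by (rule reachesE)
  obtain s' x' where s': "(U, Some (s', x')) \<in> set (dp (base_table P m) c p r)" "s' \<le> sum c B"
    using rU by (rule reachesE)
  \<comment> \<open>A stored threshold is backed by a real selection, so the sum of two thresholds
    stays within the scale ending at \<open>P\<close>.\<close>
  have "T \<le> sum p (set (cnodes l))"
  proof -
    have "represents c p l T s x"
      using dp_sound[of l m c p P] s Join.prems assms(2) by (auto simp: all_entries_def)
    then show ?thesis
      unfolding represents_def by (meson order_trans sels_subset sum_mono2 List.finite_set zero_le)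
  qed
  moreover have "U \<le> sum p (set (cnodes r))"
  proof -
    have "represents c p r U s' x'"
      using dp_sound[of r m c p P] s' Join.prems assms(2) by (auto simp: all_entries_def)
    then show ?thesis
      unfolding represents_def by (meson order_trans sels_subset sum_mono2 List.finite_set zero_le)
  qed
  ultimately have "T + U \<le> P" using Join.prems(2) nodes by linarith
  then obtain V where V: "m * (T + U) \<le> (m + 1) * V"
      "reaches (dp (base_table P m) c p (Join l r)) V (s + s')"
    unfolding dp.simps using merge_complete[OF dense_base_table[OF assms(2)] s(1) s'(1)] by blast
  have "m ^ ?d * sum p A \<le> (m + 1) ^ ?d * T" "m ^ ?d * sum p B \<le> (m + 1) ^ ?d * U"
    by (rule power_ratio_mono[OF T] power_ratio_mono[OF U], simp)+
  then have le: "m ^ ?d * sum p S \<le> (m + 1) ^ ?d * (T + U)"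
    using AB unfolding S by (simp only: sum.union_disjoint distrib_left add_mono)
  have Suc: "z ^ (?d + 1) * y = z * (z ^ ?d * y)" for z y :: nat
    by (simp only: Suc_eq_plus1[symmetric] power_Suc mult.assoc)
  \<comment> \<open>The rounding of \<open>T + U\<close> to \<open>V\<close> contributes the one
    additional factor.\<close>
  from le have "m * (m ^ ?d * sum p S) \<le> m * ((m + 1) ^ ?d * (T + U))"
    by (rule mult_le_mono2)
  also have "\<dots> = (m + 1) ^ ?d * (m * (T + U))" by (rule mult.left_commute)
  also have "\<dots> \<le> (m + 1) ^ ?d * ((m + 1) * V)" by (rule mult_le_mono2[OF V(1)])
  also have "\<dots> = (m + 1) * ((m + 1) ^ ?d * V)" by (rule mult.left_commute)
  also have "\<dots> = (m + 1) ^ (?d + 1) * V" by (rule Suc[symmetric])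
  finally have "m ^ (?d + 1) * sum p S \<le> (m + 1) ^ (?d + 1) * V"
    unfolding Suc .
  moreover have "reaches (dp (base_table P m) c p (Join l r)) V (sum c S)"
    using V(2) s s' AB unfolding S by (elim reaches_mono) (simp add: sum.union_disjoint)
  ultimately show ?case unfolding jdepth.simps by blast
qed

section \<open>Reading off a solution\<close>

lemma pick_correct:
  assumes "sorted (map fst tab)"
  shows "(pick C tab best = best \<and> all_entries (\<lambda>T s x. C < s) tab) \<or>
    (\<exists>T s. (T, Some (s, pick C tab best)) \<in> set tab \<and> s \<le> C \<and>
      all_entries (\<lambda>T' s' x'. s' \<le> C \<longrightarrow> T' \<le> T) tab)"
  using assms
proof (induction C tab best rule: pick.induct)
  case (2 C T tab best)
  then show ?case by fastforce
next
  case (3 C T s x tab best)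
  define best' where "best' = (if C < s then best else x)"
  have "\<forall>T'\<in>fst ` set tab. T \<le> T'" using 3 by simp
  then have T: "T \<le> T'" if "(T', r) \<in> set tab" for T' r using that by force
  from 3 have "(pick C tab best' = best' \<and> all_entries (\<lambda>T s x. C < s) tab) \<or>
    (\<exists>T s. (T, Some (s, pick C tab best')) \<in> set tab \<and> s \<le> C \<and>
      all_entries (\<lambda>T' s' x'. s' \<le> C \<longrightarrow> T' \<le> T) tab)"
    by (simp add: best'_def)
  then show ?case
  proof
    assume *: "pick C tab best' = best' \<and> all_entries (\<lambda>T s x. C < s) tab"
    then show ?thesis
    proof (cases "C < s")
      case False
      have "all_entries (\<lambda>T' s' x'. s' \<le> C \<longrightarrow> T' \<le> T) tab"
        using * unfolding all_entries_def by (meson leD)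
      then show ?thesis using * False by (intro disjI2 exI[of _ T] exI[of _ s]) (auto simp: best'_def)
    qed (simp add: best'_def)
  next
    assume "\<exists>T s. (T, Some (s, pick C tab best')) \<in> set tab \<and> s \<le> C \<and>
      all_entries (\<lambda>T' s' x'. s' \<le> C \<longrightarrow> T' \<le> T) tab"
    then show ?thesis using T unfolding best'_def by fastforce
  qed
qed simp

lemma dp_pick:
  assumes "distinct (cnodes e)" and "0 < m" and "sum p (set (cnodes e)) \<le> P"
    and "S \<in> sels e" and "sum c S \<le> C"
  defines "x \<equiv> pick C (dp (base_table P m) c p e) SEmpty"
  shows "set (snodes x) \<in> sels e" and "distinct (snodes x)" and "ssize x \<le> csize e"
    and "sum c (set (snodes x)) \<le> C"
    and "m ^ (jdepth e + 1) * sum p S \<le> (m + 1) ^ (jdepth e + 1) * sum p (set (snodes x))"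
proof -
  let ?tab = "dp (base_table P m) c p e"
  obtain T where T: "m ^ (jdepth e + 1) * sum p S \<le> (m + 1) ^ (jdepth e + 1) * T"
    and r: "reaches ?tab T (sum c S)"
    using dp_complete[OF assms(1-4)] by blast
  obtain s y where s: "(T, Some (s, y)) \<in> set ?tab" "s \<le> sum c S"
    using r by (rule reachesE)
  have "sorted (map fst ?tab)"
    using dense_sorted[OF dense_base_table[OF assms(2)]] by simp
  \<comment> \<open>The entry that covers \<open>S\<close> fits into \<open>C\<close>, which rules
    out the case that nothing fits; the picked threshold is at least as high.\<close>
  from pick_correct[OF this, of C SEmpty] s assms(5)
  obtain T' s' where "(T', Some (s', x)) \<in> set ?tab" "s' \<le> C" and T': "T \<le> T'"
    unfolding x_def[symmetric] all_entries_def by fastforce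
  then have R: "represents c p e T' s' x" and C: "s' \<le> C"
    using dp_sound[OF assms(1,2), of c p P] by (auto simp: all_entries_def)
  then show "set (snodes x) \<in> sels e" "distinct (snodes x)" "ssize x \<le> csize e"
    "sum c (set (snodes x)) \<le> C"
    by (auto simp: represents_def)
  have "T \<le> sum p (set (snodes x))" using R T' by (auto simp: represents_def)
  then show "m ^ (jdepth e + 1) * sum p S \<le> (m + 1) ^ (jdepth e + 1) * sum p (set (snodes x))"
    using T by (meson mult_le_mono2 order_trans)
qed

section \<open>The number of thresholds\<close>

lemma log2_one_plus: "0 \<le> x \<Longrightarrow> x \<le> 1 / 2 \<Longrightarrow> x / 2 \<le> log 2 (1 + x)" for x :: real
proof -
  assume x: "0 \<le> x" "x \<le> 1 / 2"
  have "x * x \<le> x * (1 / 2)" using x by (intro mult_left_mono) auto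
  then have "x / 2 \<le> x - x\<^sup>2" by (simp add: power2_eq_square)
  also have "\<dots> \<le> ln (1 + x)" using x by (intro ln_one_plus_pos_lower_bound) auto
  also have "\<dots> \<le> ln (1 + x) / ln 2"
    using x ln_2_less_1 by (simp add: le_divide_eq mult_left_le)
  finally show ?thesis by (simp add: log_def)
qed

text \<open>Each step multiplies \<open>T\<close> by at least 1 + 1/(2m) and hence raises its binary
  logarithm by at least 1/(4m).\<close>

lemma length_thresholds:
  assumes "0 < m" and "1 \<le> T" and "T \<le> P"
  shows "real (length (thresholds P m T)) \<le> 1 + 4 * real m * (log 2 (real P) - log 2 (real T))"
  using assms
proof (induction P m T rule: thresholds.induct)
  case (1 P m T)
  define T' where "T' = T + max 1 (T div m)"
  have len: "length (thresholds P m T) = 1 + length (thresholds P m T')"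
    using 1 by (subst thresholds.simps) (simp add: T'_def)
  show ?case
  proof (cases "T' \<le> P")
    case True
    \<comment> \<open>Below \<open>2 * m\<close> the step 1 is large enough; from there on, taking
      the floor of T/m loses at most half of it.\<close>
    have "real T / (2 * real m) \<le> real (max 1 (T div m))"
    proof (cases "T < 2 * m")
      case True
      then have "real T \<le> 2 * real m" by simp
      then have "real T / (2 * real m) \<le> 1" using 1 by (simp add: field_simps)
      then show ?thesis by simp
    next
      case False
      have "T < (T div m + 1) * m"
        using 1 by (metis Suc_eq_plus1 dividend_less_div_times mult.commute mult_Suc_right)
      then have "2 * T < 2 * (T div m) * m + 2 * m" by (simp add: algebra_simps)
      then have "T \<le> 2 * (T div m) * m" using False by linarith
      then have "real T \<le> real (2 * (T div m) * m)" by (simp only: of_nat_le_iff)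
      then have "real T / (2 * real m) \<le> real (T div m)" using 1 by (simp add: field_simps)
      then show ?thesis by simp
    qed
    then have "real T * (1 + 1 / (2 * real m)) \<le> real T'"
      unfolding T'_def of_nat_add by (simp add: algebra_simps)
    then have "log 2 (real T * (1 + 1 / (2 * real m))) \<le> log 2 (real T')"
      using 1 by (subst log_le_cancel_iff) (auto intro!: mult_pos_pos add_pos_nonneg simp: T'_def)
    moreover have "log 2 (real T * (1 + 1 / (2 * real m))) = log 2 (real T) + log 2 (1 + 1 / (2 * real m))"
      using 1 by (intro log_mult_pos) (auto intro!: add_pos_nonneg)
    moreover have "1 / (2 * real m) / 2 \<le> log 2 (1 + 1 / (2 * real m))"
      using 1 by (intro log2_one_plus) (auto simp: field_simps)
    ultimately have "1 / (4 * real m) \<le> log 2 (real T') - log 2 (real T)" by simp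
    then have step: "1 \<le> 4 * real m * (log 2 (real T') - log 2 (real T))"
      using 1 by (simp add: field_simps)
    have "real (length (thresholds P m T')) \<le> 1 + 4 * real m * (log 2 (real P) - log 2 (real T'))"
      using 1 True by (simp add: T'_def)
    then show ?thesis using step unfolding len by (simp add: algebra_simps)
  next
    case False
    then have "thresholds P m T' = []" by (subst thresholds.simps) simp
    moreover have "log 2 (real T) \<le> log 2 (real P)" using 1 by simp
    ultimately show ?thesis unfolding len by simp
  qed
qed

text \<open>The additive 2 stems from the entry at 0 and from \<open>length_thresholds\<close>; it
  is absorbed because \<open>m * lg z\<close> is at least 1.\<close>

lemma length_base_table:
  assumes "0 < m" and "real P \<le> z"
  shows "real (length (base_table P m)) \<le> 6 * real m * lg z"
proof -
  have m: "1 \<le> real m" using assms by simp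
  have lg: "1 \<le> lg z" by (simp add: lg_def)
  have ml: "1 \<le> real m * lg z" using mult_mono[OF m lg] by simp
  show ?thesis
  proof (cases "P = 0")
    case True
    then show ?thesis using ml by (simp add: base_table_def thresholds.simps)
  next
    case False
    then have "real (length (base_table P m)) \<le> 2 + 4 * real m * log 2 (real P)"
      using length_thresholds[OF assms(1), of 1 P] by (simp add: base_table_def)
    also have "log 2 (real P) \<le> lg z"
      using False assms(2) by (auto simp: lg_def intro!: max.coboundedI2)
    then have "2 + 4 * real m * log 2 (real P) \<le> 2 + 4 * (real m * lg z)"
      by (simp add: mult_left_mono)
    finally show ?thesis using ml by simp
  qed
qed


section \<open>The program\<close>

text \<open>Positions in \<open>scheme\<close>, with 0 left to the entry point. As opaque constants
  they let calls be rewritten by name.\<close>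

definition "fn_conv = (1::nat)"
definition "fn_convs = (2::nat)"
definition "fn_balance = (3::nat)"
definition "fn_pair_up = (4::nat)"
definition "fn_depth = (5::nat)"
definition "fn_profit = (6::nat)"
definition "fn_thresholds = (7::nat)"
definition "fn_better = (8::nat)"
definition "fn_row = (9::nat)"
definition "fn_merge = (10::nat)"
definition "fn_ins = (11::nat)"
definition "fn_dp = (12::nat)"
definition "fn_pick = (13::nat)"
definition "fn_flat = (14::nat)"

definition conv_code :: exp where
  "conv_code =
     Cons (Const 1) (Cons (Fst (Var 0)) (Cons (Fst (Snd (Var 0))) (Cons (Fst (Snd (Snd (Var 0))))
       (Call fn_balance (Call fn_convs (Snd (Snd (Snd (Var 0)))))))))"

definition convs_code :: exp where
  "convs_code =
     If (IsPair (Var 0)) (Cons (Call fn_conv (Fst (Var 0))) (Call fn_convs (Snd (Var 0)))) (Const 0)"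

definition balance_code :: exp where
  "balance_code =
     If (IsPair (Var 0))
       (If (IsPair (Snd (Var 0))) (Call fn_balance (Call fn_pair_up (Var 0))) (Fst (Var 0)))
       (Const 0)"

definition pair_up_code :: exp where
  "pair_up_code =
     If (IsPair (Var 0))
       (If (IsPair (Snd (Var 0)))
         (Cons (Cons (Const 0) (Cons (Fst (Var 0)) (Fst (Snd (Var 0)))))
           (Call fn_pair_up (Snd (Snd (Var 0)))))
         (Var 0))
       (Var 0)"

definition depth_code :: exp where
  "depth_code =
     If (IsPair (Var 0))
       (If (Fst (Var 0))
         (Call fn_depth (Snd (Snd (Snd (Snd (Var 0))))))
         (Let (Call fn_depth (Fst (Snd (Var 0))))
           (Let (Call fn_depth (Snd (Snd (Var 1))))
             (Arith Add (If (Arith Less (Var 0) (Var 1)) (Var 1) (Var 0)) (Const 1)))))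
       (Const 0)"

definition profit_code :: exp where
  "profit_code =
     If (IsPair (Var 0))
       (If (Fst (Var 0))
         (Arith Add (Fst (Snd (Snd (Snd (Var 0))))) (Call fn_profit (Snd (Snd (Snd (Snd (Var 0)))))))
         (Arith Add (Call fn_profit (Fst (Snd (Var 0)))) (Call fn_profit (Snd (Snd (Var 0))))))
       (Const 0)"

definition thresholds_code :: exp where
  "thresholds_code =
     If (Arith Less (Fst (Var 0)) (Snd (Snd (Var 0)))) (Const 0)
       (Cons (Cons (Snd (Snd (Var 0))) (Const 0))
         (Call fn_thresholds (Cons (Fst (Var 0)) (Cons (Fst (Snd (Var 0)))
           (Arith Add (Snd (Snd (Var 0)))
             (Let (Arith Div (Snd (Snd (Var 0))) (Fst (Snd (Var 0)))) (If (Var 0) (Var 0) (Const 1))))))))"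

definition better_code :: exp where
  "better_code =
     If (IsPair (Fst (Var 0)))
       (If (Arith Less (Fst (Snd (Var 0))) (Fst (Fst (Var 0)))) (Snd (Var 0)) (Fst (Var 0)))
       (Snd (Var 0))"

text \<open>After the three bindings, \<open>Var 2\<close>, \<open>Var 1\<close> and
  \<open>Var 0\<close> are the three components of the argument; \<open>merge_code\<close>,
  \<open>ins_code\<close> and \<open>pick_code\<close> begin in the same way. The nested test yields
  true also when there is no next threshold.\<close>

definition row_code :: exp where
  "row_code =
     Let (Fst (Var 0)) (Let (Fst (Snd (Var 1))) (Let (Snd (Snd (Var 2)))
       (If (IsPair (Var 0))
         (If (IsPair (Snd (Fst (Var 0))))
           (If (If (IsPair (Snd (Var 1)))
                 (Arith Less (Arith Add (Fst (Var 2)) (Fst (Fst (Var 0)))) (Fst (Fst (Snd (Var 1)))))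
                 (Const 1))
             (Call fn_row (Cons (Var 2) (Cons
               (Cons (Cons (Fst (Fst (Var 1)))
                 (Call fn_better (Cons (Snd (Fst (Var 1)))
                   (Cons (Arith Add (Fst (Snd (Var 2))) (Fst (Snd (Fst (Var 0)))))
                     (Cons (Snd (Snd (Var 2))) (Snd (Snd (Fst (Var 0)))))))))
                 (Snd (Var 1)))
               (Snd (Var 0)))))
             (Cons (Fst (Var 1)) (Call fn_row (Cons (Var 2) (Cons (Snd (Var 1)) (Var 0))))))
           (Call fn_row (Cons (Var 2) (Cons (Var 1) (Snd (Var 0))))))
         (Var 1))))"

definition merge_code :: exp where
  "merge_code =
     Let (Fst (Var 0)) (Let (Fst (Snd (Var 1))) (Let (Snd (Snd (Var 2)))
       (If (IsPair (Var 2))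
         (Call fn_merge (Cons (Snd (Var 2)) (Cons (Var 1)
           (If (IsPair (Snd (Fst (Var 2))))
             (Call fn_row (Cons (Fst (Var 2)) (Cons (Var 0) (Var 1))))
             (Var 0)))))
         (Var 0))))"

definition ins_code :: exp where
  "ins_code =
     Let (Fst (Var 0)) (Let (Fst (Snd (Var 1))) (Let (Snd (Snd (Var 2)))
       (If (IsPair (Var 0))
         (If (Arith Less (Var 2) (Fst (Fst (Var 0))))
           (Var 0)
           (Cons (Cons (Fst (Fst (Var 0))) (Call fn_better (Cons (Snd (Fst (Var 0))) (Var 1))))
             (Call fn_ins (Cons (Var 2) (Cons (Var 1) (Snd (Var 0)))))))
         (Const 0))))"

definition dp_code :: exp where
  "dp_code =
     Let (Fst (Var 0)) (Let (Snd (Var 1))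
       (If (IsPair (Var 0))
         (If (Fst (Var 0))
           (Call fn_ins (Cons (Fst (Snd (Snd (Snd (Var 0)))))
             (Cons (Cons (Fst (Snd (Snd (Var 0)))) (Arith Add (Fst (Snd (Var 0))) (Const 1)))
               (Call fn_dp (Cons (Var 1) (Snd (Snd (Snd (Snd (Var 0))))))))))
           (Call fn_merge (Cons (Call fn_dp (Cons (Var 1) (Fst (Snd (Var 0)))))
             (Cons (Call fn_dp (Cons (Var 1) (Snd (Snd (Var 0))))) (Var 1)))))
         (Var 1)))"

definition pick_code :: exp where
  "pick_code =
     Let (Fst (Var 0)) (Let (Fst (Snd (Var 1))) (Let (Snd (Snd (Var 2)))
       (If (IsPair (Var 1))
         (Call fn_pick (Cons (Var 2) (Cons (Snd (Var 1))
           (If (IsPair (Snd (Fst (Var 1))))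
             (If (Arith Less (Var 2) (Fst (Snd (Fst (Var 1))))) (Var 0) (Snd (Snd (Fst (Var 1)))))
             (Var 0)))))
         (Var 0))))"

definition flat_code :: exp where
  "flat_code =
     If (IsPair (Fst (Var 0)))
       (Call fn_flat (Cons (Fst (Fst (Var 0))) (Call fn_flat (Cons (Snd (Fst (Var 0))) (Snd (Var 0))))))
       (If (Fst (Var 0)) (Cons (Arith Sub (Fst (Var 0)) (Const 1)) (Snd (Var 0))) (Snd (Var 0)))"

text \<open>The three bindings are the binary tree, the resolution \<open>m\<close> and the base
  table; in the last expression \<open>Var 3\<close> is the input. The list being flattened and the
  initial choice of \<open>fn_pick\<close> are both encoded by 0.\<close>

definition main_code :: exp where
  "main_code =
     Let (Call fn_balance (Call fn_convs (Snd (Snd (Snd (Var 0))))))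
     (Let (Arith Add (Arith Div (Arith Mul (Arith Mul (Const 2) (Arith Add (Call fn_depth (Var 0)) (Const 1)))
             (Fst (Snd (Var 1)))) (Fst (Var 1))) (Const 1))
     (Let (Cons (Cons (Const 0) (Cons (Const 0) (Const 0)))
             (Call fn_thresholds (Cons (Call fn_profit (Var 1)) (Cons (Var 0) (Const 1)))))
       (Call fn_flat (Cons
         (Call fn_pick (Cons (Fst (Snd (Snd (Var 3))))
           (Cons (Call fn_dp (Cons (Var 0) (Var 2))) (Const 0))))
         (Const 0)))))"

definition scheme :: prog where
  "scheme = [main_code, conv_code, convs_code, balance_code, pair_up_code, depth_code, profit_code,
     thresholds_code, better_code, row_code, merge_code, ins_code, dp_code, pick_code, flat_code]"

lemma scheme_nth [simp]:
  "scheme ! 0 = main_code"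
  "scheme ! fn_conv = conv_code"
  "scheme ! fn_convs = convs_code"
  "scheme ! fn_balance = balance_code"
  "scheme ! fn_pair_up = pair_up_code"
  "scheme ! fn_depth = depth_code"
  "scheme ! fn_profit = profit_code"
  "scheme ! fn_thresholds = thresholds_code"
  "scheme ! fn_better = better_code"
  "scheme ! fn_row = row_code"
  "scheme ! fn_merge = merge_code"
  "scheme ! fn_ins = ins_code"
  "scheme ! fn_dp = dp_code"
  "scheme ! fn_pick = pick_code"
  "scheme ! fn_flat = flat_code"
  by (simp_all add: scheme_def fn_conv_def fn_convs_def fn_balance_def fn_pair_up_def fn_depth_def
    fn_profit_def fn_thresholds_def fn_better_def fn_row_def fn_merge_def fn_ins_def fn_dp_def
    fn_pick_def fn_flat_def)

lemma fn_less [simp]: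
  "scheme \<noteq> []"
  "fn_conv < length scheme"
  "fn_convs < length scheme"
  "fn_balance < length scheme"
  "fn_pair_up < length scheme"
  "fn_depth < length scheme"
  "fn_profit < length scheme"
  "fn_thresholds < length scheme"
  "fn_better < length scheme"
  "fn_row < length scheme"
  "fn_merge < length scheme"
  "fn_ins < length scheme"
  "fn_dp < length scheme"
  "fn_pick < length scheme"
  "fn_flat < length scheme"
  by (simp_all add: scheme_def fn_conv_def fn_convs_def fn_balance_def fn_pair_up_def fn_depth_def
    fn_profit_def fn_thresholds_def fn_better_def fn_row_def fn_merge_def fn_ins_def fn_dp_def
    fn_pick_def fn_flat_def)

text \<open>The tag 0 or 1 tells \<open>Join\<close> from \<open>Sel\<close>, and \<open>Bot\<close>
  is the only non-pair. Sizes and profits travel with the node, so no lookup by name is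
  needed.\<close>

fun enc_ctree :: "(nat \<Rightarrow> nat) \<Rightarrow> (nat \<Rightarrow> nat) \<Rightarrow> ctree \<Rightarrow> val" where
  "enc_ctree c p Bot = Num 0"
| "enc_ctree c p (Join l r) = Pair (Num 0) (Pair (enc_ctree c p l) (enc_ctree c p r))"
| "enc_ctree c p (Sel j e) =
     Pair (Num 1) (Pair (Num j) (Pair (Num (c j)) (Pair (Num (p j)) (enc_ctree c p e))))"

text \<open>The successor in \<open>enc_sol\<close> tells node 0 from the empty selection.\<close>

fun enc_sol :: "sol \<Rightarrow> val" where
  "enc_sol SEmpty = Num 0"
| "enc_sol (SOne j) = Num (Suc j)"
| "enc_sol (SJoin x y) = Pair (enc_sol x) (enc_sol y)"

fun enc_entry :: "(nat \<times> sol) option \<Rightarrow> val" where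
  "enc_entry None = Num 0"
| "enc_entry (Some (s, x)) = Pair (Num s) (enc_sol x)"

fun enc_table :: "table \<Rightarrow> val" where
  "enc_table [] = Num 0"
| "enc_table ((T, r) # tab) = Pair (Pair (Num T) (enc_entry r)) (enc_table tab)"

section \<open>Step bounds for the individual functions\<close>

definition runs :: "nat \<Rightarrow> nat \<Rightarrow> val \<Rightarrow> val \<Rightarrow> nat \<Rightarrow> bool" where
  "runs W f v r B \<longleftrightarrow> (\<exists>t\<le>B. fcall W scheme f v = Some (r, t))"

lemma runsI:
  assumes "f < length scheme"
    and "case ex W scheme [v] (scheme ! f) of Some (r', t) \<Rightarrow> r' = r \<and> t \<le> B | None \<Rightarrow> False"
  shows "runs W f v r B"
  using assms fcallI[OF assms(1)] by (fastforce simp: runs_def split: option.splits)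

lemma runsE:
  assumes "runs W f v r B" obtains t where "fcall W scheme f v = Some (r, t)" and "t \<le> B"
  using assms by (auto simp: runs_def)

lemma runs_pair_up:
  assumes "4 < W"
  shows "runs W fn_pair_up (enc_list (map (enc_ctree c p) xs))
    (enc_list (map (enc_ctree c p) (pair_up xs))) (40 * length xs + 20)"
proof (induction xs rule: pair_up.induct)
  case (1 x y xs)
  then obtain t where "fcall W scheme fn_pair_up (enc_list (map (enc_ctree c p) xs)) =
      Some (enc_list (map (enc_ctree c p) (pair_up xs)), t)" "t \<le> 40 * length xs + 20"
    by (rule runsE)
  then show ?case using assms by (intro runsI) (auto simp: pair_up_code_def)
qed (use assms in \<open>auto intro!: runsI simp: pair_up_code_def\<close>)

text \<open>A geometric sum: the next round has about half the length, so half of the bound remains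
  for the current \<open>pair_up\<close>.\<close>

lemma runs_balance:
  assumes "4 < W"
  shows "runs W fn_balance (enc_list (map (enc_ctree c p) xs))
    (enc_ctree c p (balance xs)) (300 * length xs + 100)"
proof (induction xs rule: balance.induct)
  case (3 x y xs)
  let ?xs = "x # y # xs"
  from runs_pair_up[OF assms] obtain t where t: "fcall W scheme fn_pair_up (enc_list (map (enc_ctree c p) ?xs)) =
      Some (enc_list (map (enc_ctree c p) (pair_up ?xs)), t)" "t \<le> 40 * length ?xs + 20"
    by (rule runsE)
  from 3 obtain u where u: "fcall W scheme fn_balance (enc_list (map (enc_ctree c p) (pair_up ?xs))) =
      Some (enc_ctree c p (balance (pair_up ?xs)), u)" "u \<le> 300 * length (pair_up ?xs) + 100"
    by (rule runsE)
  have "2 * length (pair_up ?xs) \<le> length ?xs + 1" unfolding length_pair_up by linarith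
  then show ?case using assms t u
    by (intro runsI) (auto simp: balance_code_def simp del: pair_up.simps)
qed (use assms in \<open>auto intro!: runsI simp: balance_code_def\<close>)

text \<open>The summand \<open>300 * length ts\<close> on the left is credit for the later call of
  \<open>fn_balance\<close> on the converted siblings, so the total stays linear.\<close>

lemma runs_convs:
  assumes "4 < W"
  shows "\<exists>t. fcall W scheme fn_convs (enc_list (map (enc_tree c p) ts)) =
      Some (enc_list (map (enc_ctree c p) (map conv ts)), t) \<and>
    t + 300 * length ts \<le> 1000 * length (forest_nodes ts) + 20"
proof (induction ts rule: forest_induct)
  case Nil
  have "fcall W scheme fn_convs (Num 0) = Some (Num 0, 4)"
    using assms by (intro fcallI) (auto simp: convs_code_def)
  then show ?case by simp
next
  case (Cons j us ts)
  from Cons(1) obtain t where t: "fcall W scheme fn_convs (enc_list (map (enc_tree c p) us)) =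
      Some (enc_list (map (enc_ctree c p) (map conv us)), t)"
      "t + 300 * length us \<le> 1000 * length (forest_nodes us) + 20" by blast
  from Cons(2) obtain u where u: "fcall W scheme fn_convs (enc_list (map (enc_tree c p) ts)) =
      Some (enc_list (map (enc_ctree c p) (map conv ts)), u)"
      "u + 300 * length ts \<le> 1000 * length (forest_nodes ts) + 20" by blast
  from runs_balance[OF assms, of c p "map conv us"]
  obtain s where s: "fcall W scheme fn_balance (enc_list (map (enc_ctree c p) (map conv us))) =
      Some (enc_ctree c p (balance (map conv us)), s)" "s \<le> 300 * length us + 100"
    by (auto elim: runsE)
  have "runs W fn_conv (enc_tree c p (Node j us)) (enc_ctree c p (conv (Node j us))) (s + t + 50)"
    using assms t s by (intro runsI) (auto simp: conv_code_def)
  then obtain r where r: "fcall W scheme fn_conv (enc_tree c p (Node j us)) =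
      Some (enc_ctree c p (conv (Node j us)), r)" "r \<le> s + t + 50"
    by (rule runsE)
  have "runs W fn_convs (enc_list (map (enc_tree c p) (Node j us # ts)))
      (enc_list (map (enc_ctree c p) (map conv (Node j us # ts)))) (r + u + 50)"
    using assms r u by (intro runsI) (auto simp: convs_code_def)
  then obtain q where "fcall W scheme fn_convs (enc_list (map (enc_tree c p) (Node j us # ts))) =
      Some (enc_list (map (enc_ctree c p) (map conv (Node j us # ts))), q)" "q \<le> r + u + 50"
    by (rule runsE)
  then show ?case using t u s r by (intro exI[of _ q]) auto
qed

lemma runs_depth:
  assumes "4 < W" and "csize e < W"
  shows "runs W fn_depth (enc_ctree c p e) (Num (jdepth e)) (60 * csize e)"
  using assms(2)
proof (induction e)
  case (Join l r)
  then have "runs W fn_depth (enc_ctree c p l) (Num (jdepth l)) (60 * csize l)"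
    "runs W fn_depth (enc_ctree c p r) (Num (jdepth r)) (60 * csize r)" by auto
  then obtain t u where "fcall W scheme fn_depth (enc_ctree c p l) = Some (Num (jdepth l), t)"
    "fcall W scheme fn_depth (enc_ctree c p r) = Some (Num (jdepth r), u)"
    "t \<le> 60 * csize l" "u \<le> 60 * csize r" by (auto elim!: runsE)
  then show ?case using assms(1) Join.prems jdepth_le_length[of l] jdepth_le_length[of r]
    by (intro runsI) (auto simp: depth_code_def)
next
  case (Sel j e)
  then have "runs W fn_depth (enc_ctree c p e) (Num (jdepth e)) (60 * csize e)" by auto
  then obtain t where "fcall W scheme fn_depth (enc_ctree c p e) = Some (Num (jdepth e), t)"
    "t \<le> 60 * csize e" by (auto elim!: runsE)
  then show ?case using assms(1) by (intro runsI) (auto simp: depth_code_def)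
qed (use assms in \<open>auto intro!: runsI simp: depth_code_def\<close>)

lemma runs_profit:
  assumes "4 < W" and "sum_list (map p (cnodes e)) < W"
  shows "runs W fn_profit (enc_ctree c p e) (Num (sum_list (map p (cnodes e)))) (60 * csize e)"
  using assms(2)
proof (induction e)
  case (Join l r)
  let ?p = "\<lambda>e. sum_list (map p (cnodes e))"
  from Join have "runs W fn_profit (enc_ctree c p l) (Num (?p l)) (60 * csize l)"
    "runs W fn_profit (enc_ctree c p r) (Num (?p r)) (60 * csize r)" by auto
  then obtain t u where "fcall W scheme fn_profit (enc_ctree c p l) = Some (Num (?p l), t)"
    "fcall W scheme fn_profit (enc_ctree c p r) = Some (Num (?p r), u)"
    "t \<le> 60 * csize l" "u \<le> 60 * csize r" by (auto elim!: runsE)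
  then show ?case using assms(1) Join.prems by (intro runsI) (auto simp: profit_code_def)
next
  case (Sel j e)
  let ?p = "\<lambda>e. sum_list (map p (cnodes e))"
  from Sel have "runs W fn_profit (enc_ctree c p e) (Num (?p e)) (60 * csize e)" by auto
  then obtain t where "fcall W scheme fn_profit (enc_ctree c p e) = Some (Num (?p e), t)"
    "t \<le> 60 * csize e" by (auto elim!: runsE)
  then show ?case using assms(1) Sel.prems by (intro runsI) (auto simp: profit_code_def)
qed (use assms in \<open>auto intro!: runsI simp: profit_code_def\<close>)

text \<open>The last threshold computed may exceed \<open>P\<close>, but a step from T \<le> P ends
  at most at 2T or T + 1; hence the room required of \<open>W\<close>.\<close>

lemma runs_thresholds:
  assumes "4 < W" and "2 * P + 1 < W"
  shows "runs W fn_thresholds (Pair (Num P) (Pair (Num m) (Num T)))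
    (enc_table (thresholds P m T)) (60 * length (thresholds P m T) + 20)"
  using assms(2)
proof (induction P m T rule: thresholds.induct)
  case (1 P m T)
  show ?case
  proof (cases "P < T")
    case True
    then show ?thesis using assms(1)
      by (intro runsI) (auto simp: thresholds_code_def thresholds.simps[of P m T])
  next
    case False
    define T' where "T' = T + max 1 (T div m)"
    have T': "T + (if T div m \<noteq> 0 then T div m else 1) = T'" by (auto simp: T'_def)
    have thr: "thresholds P m T = (T, None) # thresholds P m T'"
      using False by (subst thresholds.simps) (simp add: T'_def)
    from 1(1)[OF False 1(2)] obtain t where t: "fcall W scheme fn_thresholds (Pair (Num P) (Pair (Num m) (Num T'))) =
        Some (enc_table (thresholds P m T'), t)" "t \<le> 60 * length (thresholds P m T') + 20"
      unfolding T'_def by (rule runsE)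
    have "T div m \<le> T" by simp
    then have W: "T div m < W" "T + T div m < W" "Suc T < W"
      using False 1(2) by linarith+
    show ?thesis
    proof (cases "T div m = 0")
      case True
      then have "T' = Suc T" by (simp add: T'_def)
      then show ?thesis unfolding thr using False True t W assms(1)
        by (intro runsI) (auto simp: thresholds_code_def)
    next
      case nz: False
      then have "T' = T + T div m" by (simp add: T'_def)
      then show ?thesis unfolding thr using False nz t W assms(1)
        by (intro runsI) (auto simp: thresholds_code_def)
    qed
  qed
qed

lemma runs_better:
  assumes "4 < W"
  shows "runs W fn_better (Pair (enc_entry r) (enc_entry (Some y))) (enc_entry (better r y)) 30"
  using assms by (intro runsI; cases r; cases y) (auto simp: better_code_def)

text \<open>Guards against overflow: with \<open>2 * B < W\<close>, the sums of two thresholds or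
  two sizes are words.\<close>

definition bounded :: "nat \<Rightarrow> table \<Rightarrow> bool" where
  "bounded B tab \<longleftrightarrow> (\<forall>(T, r)\<in>set tab. T \<le> B) \<and> all_entries (\<lambda>T s x. s \<le> B) tab"

lemma bounded_simps [simp]:
  "bounded B []"
  "bounded B ((T, None) # tab) \<longleftrightarrow> T \<le> B \<and> bounded B tab"
  "bounded B ((T, Some (s, x)) # tab) \<longleftrightarrow> T \<le> B \<and> s \<le> B \<and> bounded B tab"
  by (auto simp: bounded_def)

text \<open>Each call shortens \<open>rs\<close> or \<open>es\<close>, so the cost is additive in
  the two lengths. This makes a whole merge quadratic instead of cubic.\<close>

lemma runs_row:
  assumes "4 < W" and "2 * B < W" and "T \<le> B" and "s \<le> B" and "bounded B es" and "rs \<noteq> []"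
  shows "runs W fn_row (Pair (Pair (Num T) (enc_entry (Some (s, x)))) (Pair (enc_table rs) (enc_table es)))
    (enc_table (row T s x rs es)) (150 * (length rs + length es) + 50)"
  using assms(3-)
proof (induction T s x rs es rule: row.induct)
  case (1 T s x rs)
  then show ?case using assms(1) by (intro runsI) (auto simp: row_code_def)
next
  case (2 T s x rs U es)
  then obtain t where "fcall W scheme fn_row
      (Pair (Pair (Num T) (enc_entry (Some (s, x)))) (Pair (enc_table rs) (enc_table es))) =
      Some (enc_table (row T s x rs es), t)" "t \<le> 150 * (length rs + length es) + 50"
    by (auto elim: runsE)
  then show ?case using assms(1) by (intro runsI) (auto simp: row_code_def)
next
  case (4 T s x V r rs U s' x' es)
  have W: "T + U < W" "s + s' < W" using 4 assms(2) by auto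
  let ?h = "Pair (Num T) (enc_entry (Some (s, x)))"
  let ?es = "(U, Some (s', x')) # es"
  show ?case
  proof (cases "rs \<noteq> [] \<and> fst (hd rs) \<le> T + U")
    case True
    then obtain t where t: "fcall W scheme fn_row (Pair ?h (Pair (enc_table rs) (enc_table ?es))) =
        Some (enc_table (row T s x rs ?es), t)" "t \<le> 150 * (length rs + length ?es) + 50"
      using 4 by (auto elim: runsE)
    obtain V' r' rs' where rs: "rs = (V', r') # rs'" using True by (cases rs) auto
    have "row T s x ((V, r) # rs) ?es = (V, r) # row T s x rs ?es"
      using True by simp
    then show ?thesis using t assms(1) W True unfolding rs
      by (intro runsI) (auto simp: row_code_def simp del: row.simps)
  next
    case False
    let ?b = "better r (s + s', SJoin x x')"
    from runs_better[OF assms(1), of r "(s + s', SJoin x x')"] obtain u where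
      u: "fcall W scheme fn_better (Pair (enc_entry r) (enc_entry (Some (s + s', SJoin x x')))) =
        Some (enc_entry ?b, u)" "u \<le> 30"
      by (rule runsE)
    obtain t where t: "fcall W scheme fn_row (Pair ?h (Pair (enc_table ((V, ?b) # rs)) (enc_table es))) =
        Some (enc_table (row T s x ((V, ?b) # rs) es), t)"
        "t \<le> 150 * (length ((V, ?b) # rs) + length es) + 50"
      using 4 False by (auto elim: runsE)
    have "row T s x ((V, r) # rs) ?es = row T s x ((V, ?b) # rs) es"
      using False by auto
    then show ?thesis using t u assms(1) W False
      by (cases rs; intro runsI) (auto simp: row_code_def simp del: row.simps)
  qed
qed simp

lemma runs_merge:
  assumes "4 < W" and "2 * B < W" and "bounded B ts" and "bounded B es" and "acc \<noteq> []"
  shows "runs W fn_merge (Pair (enc_table ts) (Pair (enc_table es) (enc_table acc)))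
    (enc_table (merge ts es acc)) (length ts * (150 * (length acc + length es) + 100) + 50)"
  using assms(3-)
proof (induction ts es acc rule: merge.induct)
  case (1 es acc)
  then show ?case using assms(1) by (intro runsI) (auto simp: merge_code_def)
next
  case (2 T ts es acc)
  then obtain t where "fcall W scheme fn_merge (Pair (enc_table ts) (Pair (enc_table es) (enc_table acc))) =
      Some (enc_table (merge ts es acc), t)"
      "t \<le> length ts * (150 * (length acc + length es) + 100) + 50"
    by (auto elim: runsE)
  then show ?case using assms(1) by (intro runsI) (auto simp: merge_code_def)
next
  case (3 T s x ts es acc)
  let ?acc = "row T s x acc es"
  have "?acc \<noteq> []" using "3.prems" by (metis length_0_conv length_row)
  then obtain t where t: "fcall W scheme fn_merge (Pair (enc_table ts) (Pair (enc_table es) (enc_table ?acc))) =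
      Some (enc_table (merge ts es ?acc), t)"
      "t \<le> length ts * (150 * (length acc + length es) + 100) + 50"
    using 3 by (auto elim: runsE)
  from runs_row[OF assms(1,2), of T s es acc x] "3.prems" obtain u where
    u: "fcall W scheme fn_row (Pair (Pair (Num T) (enc_entry (Some (s, x)))) (Pair (enc_table acc) (enc_table es))) =
      Some (enc_table ?acc, u)" "u \<le> 150 * (length acc + length es) + 50"
    by (auto elim: runsE)
  show ?case using t u assms(1) by (intro runsI) (auto simp: merge_code_def)
qed

lemma runs_ins:
  assumes "4 < W"
  shows "runs W fn_ins (Pair (Num q) (Pair (enc_entry (Some y)) (enc_table tab)))
    (enc_table (ins q y tab)) (100 * length tab + 30)"
proof (induction q y tab rule: ins.induct)
  case (1 q y)
  then show ?case using assms by (intro runsI) (auto simp: ins_code_def)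
next
  case (2 q y T r tab)
  show ?case
  proof (cases "q < T")
    case True
    then show ?thesis using assms by (intro runsI) (auto simp: ins_code_def)
  next
    case False
    then obtain t where t: "fcall W scheme fn_ins (Pair (Num q) (Pair (enc_entry (Some y)) (enc_table tab))) =
        Some (enc_table (ins q y tab), t)" "t \<le> 100 * length tab + 30"
      using 2 by (auto elim: runsE)
    from runs_better[OF assms, of r y] obtain u where
      "fcall W scheme fn_better (Pair (enc_entry r) (enc_entry (Some y))) = Some (enc_entry (better r y), u)"
      "u \<le> 30" by (rule runsE)
    then show ?thesis using t assms False by (intro runsI) (auto simp: ins_code_def)
  qed
qed

lemma runs_pick:
  assumes "4 < W"
  shows "runs W fn_pick (Pair (Num C) (Pair (enc_table tab) (enc_sol best)))
    (enc_sol (pick C tab best)) (100 * length tab + 30)"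
proof (induction C tab best rule: pick.induct)
  case (1 C best)
  then show ?case using assms by (intro runsI) (auto simp: pick_code_def)
next
  case (2 C T tab best)
  then obtain t where "fcall W scheme fn_pick (Pair (Num C) (Pair (enc_table tab) (enc_sol best))) =
      Some (enc_sol (pick C tab best), t)" "t \<le> 100 * length tab + 30"
    by (rule runsE)
  then show ?case using assms by (intro runsI) (auto simp: pick_code_def)
next
  case (3 C T s x tab best)
  then obtain t where "fcall W scheme fn_pick
      (Pair (Num C) (Pair (enc_table tab) (enc_sol (if C < s then best else x)))) =
      Some (enc_sol (pick C tab (if C < s then best else x)), t)" "t \<le> 100 * length tab + 30"
    by (rule runsE)
  then show ?case using assms by (cases "C < s"; intro runsI) (auto simp: pick_code_def)
qed

lemma runs_flat:
  assumes "4 < W" and "\<forall>j\<in>set (snodes x). j < W"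
  shows "runs W fn_flat (Pair (enc_sol x) (enc_list (map Num js)))
    (enc_list (map Num (snodes x @ js))) (60 * ssize x)"
  using assms(2)
proof (induction x arbitrary: js)
  case (SJoin x y)
  have "runs W fn_flat (Pair (enc_sol y) (enc_list (map Num js)))
    (enc_list (map Num (snodes y @ js))) (60 * ssize y)"
    "runs W fn_flat (Pair (enc_sol x) (enc_list (map Num (snodes y @ js))))
    (enc_list (map Num (snodes x @ snodes y @ js))) (60 * ssize x)"
    using SJoin.IH(2)[of js] SJoin.IH(1)[of "snodes y @ js"] SJoin.prems by simp_all
  then obtain t u where "fcall W scheme fn_flat (Pair (enc_sol y) (enc_list (map Num js))) =
      Some (enc_list (map Num (snodes y @ js)), t)" "t \<le> 60 * ssize y"
    "fcall W scheme fn_flat (Pair (enc_sol x) (enc_list (map Num (snodes y @ js)))) =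
      Some (enc_list (map Num (snodes x @ snodes y @ js)), u)" "u \<le> 60 * ssize x"
    by (elim runsE)
  then show ?case using assms(1) by (intro runsI) (auto simp: flat_code_def)
qed (use assms(1) in \<open>auto intro!: runsI simp: flat_code_def\<close>)


section \<open>Running time and accuracy\<close>

lemma bounded_dp:
  assumes "distinct (cnodes e)" and "0 < m" and "P \<le> B" and "sum c (set (cnodes e)) \<le> B"
  shows "bounded B (dp (base_table P m) c p e)"
  unfolding bounded_def
proof
  show "\<forall>(T, r)\<in>set (dp (base_table P m) c p e). T \<le> B"
  proof safe
    fix T r assume "(T, r) \<in> set (dp (base_table P m) c p e)"
    then have "T \<in> fst ` set (dp (base_table P m) c p e)" by force
    then have "T \<in> fst ` set (base_table P m)"
      by (metis fst_dp list.set_map)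
    then show "T \<le> B" using base_table_le assms(3) order_trans by blast
  qed
  have "s \<le> B" if "represents c p e T s x" for T s x
  proof -
    have "s \<le> sum c (set (cnodes e))"
      using that sels_subset unfolding represents_def by (metis List.finite_set sum_mono2 zero_le)
    then show ?thesis using assms(4) by simp
  qed
  then show "all_entries (\<lambda>T s x. s \<le> B) (dp (base_table P m) c p e)"
    using dp_sound[OF assms(1,2), of c p P] unfolding all_entries_def by blast
qed

text \<open>All tables have the length of the base table, so each join costs its square and each
  \<open>Sel\<close> only a linear scan.\<close>

lemma runs_dp:
  assumes "4 < W" and "2 * B < W" and "P \<le> B" and "0 < m"
    and "distinct (cnodes e)" and "sum c (set (cnodes e)) \<le> B" and "\<forall>j\<in>set (cnodes e). Suc j < W"
  shows "runs W fn_dp (Pair (enc_table (base_table P m)) (enc_ctree c p e))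
    (enc_table (dp (base_table P m) c p e)) (500 * length (base_table P m) ^ 2 * csize e)"
  using assms(5-)
proof (induction e)
  case Bot
  have "1 \<le> length (base_table P m) ^ 2" by (simp add: base_table_def)
  then show ?case using assms(1) by (intro runsI) (auto simp: dp_code_def)
next
  case (Join l r)
  let ?L = "length (base_table P m)"
  have sums: "sum c (set (cnodes l)) \<le> B" "sum c (set (cnodes r)) \<le> B"
    using Join.prems by (auto simp: sum.union_disjoint)
  have bounded: "bounded B (dp (base_table P m) c p l)" "bounded B (dp (base_table P m) c p r)"
    using Join.prems sums assms by (auto intro!: bounded_dp)
  have ne: "base_table P m \<noteq> []" by (simp add: base_table_def)
  obtain t where t: "fcall W scheme fn_dp (Pair (enc_table (base_table P m)) (enc_ctree c p l)) =
      Some (enc_table (dp (base_table P m) c p l), t)" "t \<le> 500 * ?L ^ 2 * csize l"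
    using Join sums by (auto elim: runsE)
  obtain u where u: "fcall W scheme fn_dp (Pair (enc_table (base_table P m)) (enc_ctree c p r)) =
      Some (enc_table (dp (base_table P m) c p r), u)" "u \<le> 500 * ?L ^ 2 * csize r"
    using Join sums by (auto elim: runsE)
  from runs_merge[OF assms(1,2) bounded ne]
  obtain s where s: "fcall W scheme fn_merge (Pair (enc_table (dp (base_table P m) c p l))
      (Pair (enc_table (dp (base_table P m) c p r)) (enc_table (base_table P m)))) =
      Some (enc_table (dp (base_table P m) c p (Join l r)), s)"
      "s \<le> ?L * (300 * ?L + 100) + 50"
    by (auto elim: runsE)
  have "1 \<le> ?L" by (simp add: base_table_def)
  then have "?L * 1 \<le> ?L * ?L" by (intro mult_le_mono2)
  then have L: "?L \<le> ?L ^ 2" "1 \<le> ?L ^ 2" using \<open>1 \<le> ?L\<close> by (auto simp: power2_eq_square)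
  have "s \<le> 300 * ?L ^ 2 + 100 * ?L + 50"
    using s(2) by (simp add: power2_eq_square distrib_left mult.left_commute mult.commute)
  then have "t + u + s + 40 \<le> 500 * ?L ^ 2 * csize (Join l r)"
    using t(2) u(2) L by (simp add: distrib_left)
  then show ?case using assms(1) t(1) u(1) s(1)
    by (intro runsI) (auto simp: dp_code_def simp del: csize.simps dp.simps)
next
  case (Sel j e)
  let ?L = "length (base_table P m)"
  obtain t where t: "fcall W scheme fn_dp (Pair (enc_table (base_table P m)) (enc_ctree c p e)) =
      Some (enc_table (dp (base_table P m) c p e), t)" "t \<le> 500 * ?L ^ 2 * csize e"
    using Sel by (auto elim: runsE)
  from runs_ins[OF assms(1), of "p j" "(c j, SOne j)" "dp (base_table P m) c p e"]
  obtain s where s: "fcall W scheme fn_ins (Pair (Num (p j)) (Pair (enc_entry (Some (c j, SOne j)))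
      (enc_table (dp (base_table P m) c p e)))) =
      Some (enc_table (dp (base_table P m) c p (Sel j e)), s)" "s \<le> 100 * ?L + 30"
    by (auto elim: runsE)
  have "1 \<le> ?L" by (simp add: base_table_def)
  then have "?L * 1 \<le> ?L * ?L" by (intro mult_le_mono2)
  then have L: "?L \<le> ?L ^ 2" "1 \<le> ?L ^ 2" using \<open>1 \<le> ?L\<close> by (auto simp: power2_eq_square)
  then have "t + s + 60 \<le> 500 * ?L ^ 2 * csize (Sel j e)"
    using t(2) s(2) by (simp add: distrib_left)
  then show ?case using assms(1) t(1) s(1) Sel.prems
    by (intro runsI) (auto simp: dp_code_def simp del: csize.simps dp.simps)
qed

section \<open>Word size and cost of the whole run\<close>

lemma magnitude_forest:
  "sum_list (map (\<lambda>j. j + c j + p j + 6) (forest_nodes ts)) \<le>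
     magnitude (enc_list (map (enc_tree c p) ts))"
  by (induction ts rule: forest_induct) auto

lemma length_le_forest_nodes: "length ts \<le> length (forest_nodes ts)"
proof (induction ts)
  case (Cons t ts)
  then show ?case by (cases t) simp
qed simp

text \<open>Floor plus one exceeds the quotient, so (D + 1)/m \<le> (a/b)/2 for the join depth D,
  and m is positive.\<close>

definition resolution :: "nat \<Rightarrow> nat \<Rightarrow> ctree \<Rightarrow> nat" where
  "resolution a b e = 2 * (jdepth e + 1) * b div a + 1"

lemma runs_scheme:
  fixes Js :: "tree list" and a b C :: nat and c p :: "nat \<Rightarrow> nat"
  assumes "Js \<noteq> []" and "distinct (forest_nodes Js)" and "0 < a"
  defines "W \<equiv> magnitude (enc_input a b Js c p C) ^ 3"
    and "e \<equiv> balance (map conv Js)"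
    and "P \<equiv> sum p (set (forest_nodes Js))"
    and "m \<equiv> resolution a b (balance (map conv Js))"
  shows "runs W 0 (enc_input a b Js c p C)
    (enc_list (map Num (snodes (pick C (dp (base_table P m) c p e) SEmpty))))
    (5000 * length (forest_nodes Js) * length (base_table P m) ^ 2)"
proof -
  define n where "n = length (forest_nodes Js)"
  define M where "M = magnitude (enc_input a b Js c p C)"
  define L where "L = length (base_table P m)"
  define x where "x = pick C (dp (base_table P m) c p e) SEmpty"
  have n1: "1 \<le> n" using assms(1) length_le_forest_nodes[of Js] unfolding n_def
    by (metis One_nat_def Suc_leI length_greater_0_conv order_less_le_trans)
  have len: "length Js \<le> n" using length_le_forest_nodes by (simp add: n_def)
  have sums: "sum_list (map f (forest_nodes Js)) = sum f (set (forest_nodes Js))" for f :: "nat \<Rightarrow> nat"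
    using assms(2) by (simp add: sum_list_distinct_conv_sum_set)
  have "6 * n + sum (\<lambda>j. j) (set (forest_nodes Js)) + sum c (set (forest_nodes Js)) + P + a + b + C + 6 \<le> M"
  proof -
    have "sum_list (map (\<lambda>j. j + c j + p j + 6) (forest_nodes Js)) =
        sum (\<lambda>j. j) (set (forest_nodes Js)) + sum c (set (forest_nodes Js)) + P + 6 * n"
      using assms(2) unfolding sums P_def n_def by (simp add: sum.distrib distinct_card)
    then show ?thesis
      using magnitude_forest[of c p Js] by (simp add: M_def enc_input_def)
  qed
  moreover have "j \<le> sum (\<lambda>j. j) (set (forest_nodes Js))" if "j \<in> set (forest_nodes Js)" for j
    using that by (intro member_le_sum) auto
  ultimately have M: "12 \<le> M" "3 * n + 1 < M" "sum c (set (forest_nodes Js)) \<le> M" "P \<le> M" "b \<le> M"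
    and names: "\<And>j. j \<in> set (forest_nodes Js) \<Longrightarrow> Suc j \<le> M"
    using n1 by force+
  \<comment> \<open>The product 2 (D + 1) b is bounded only by 2 M^2, so words are taken below the
    cube of M; 12 \<le> M gives the slack.\<close>
  have "12 * (M * M) \<le> M * (M * M)" using M(1) by (rule mult_le_mono1)
  then have W12: "12 * (M * M) \<le> W" by (simp add: W_def M_def power3_eq_cube mult.assoc)
  have "12 * M \<le> M * M" using M(1) by (rule mult_le_mono1)
  then have W: "4 < W" "2 * M + 1 < W" using W12 M(1) by linarith+
  have e: "cnodes e = forest_nodes Js" by (simp add: e_def cnodes_balance_conv)
  have size: "csize e \<le> 3 * n + 1" using csize_balance_conv by (simp add: e_def n_def)
  have m: "m = resolution a b e" "0 < m" by (simp_all add: m_def e_def resolution_def)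
  have depth: "jdepth e + 1 \<le> M" using jdepth_le_length[of e] size M by linarith
  have "2 * (jdepth e + 1) * b \<le> 2 * M * M"
    using depth M(5) by (intro mult_le_mono mult_le_mono2) auto
  moreover have "2 * M * M = 2 * (M * M)" "2 * (jdepth e + 1) \<le> 2 * M" using depth by auto
  ultimately have Wm: "2 * (jdepth e + 1) * b + 1 < W" "2 * (jdepth e + 1) < W"
    using W12 W by linarith+
  have Wm': "2 * (jdepth e + 1) * b div a + 1 < W"
    using Wm(1) div_le_dividend[of "2 * (jdepth e + 1) * b" a] by linarith

  from runs_convs[OF W(1), of c p Js] obtain t1 where
    t1: "fcall W scheme fn_convs (enc_list (map (enc_tree c p) Js)) =
      Some (enc_list (map (enc_ctree c p) (map conv Js)), t1)" "t1 \<le> 1000 * n + 20"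
    by (auto simp: n_def)
  from runs_balance[OF W(1), of c p "map conv Js"] obtain t2 where
    t2: "fcall W scheme fn_balance (enc_list (map (enc_ctree c p) (map conv Js))) =
      Some (enc_ctree c p e, t2)" "t2 \<le> 300 * n + 100"
    unfolding e_def using len by (auto elim!: runsE)
  have "csize e < W" using size M W by linarith
  from runs_depth[OF W(1) this, of c p] obtain t3 where
    t3: "fcall W scheme fn_depth (enc_ctree c p e) = Some (Num (jdepth e), t3)" "t3 \<le> 60 * csize e"
    by (rule runsE)
  have "sum_list (map p (cnodes e)) < W" using M W unfolding e sums P_def by linarith
  from runs_profit[OF W(1) this, of c] obtain t4 where
    t4: "fcall W scheme fn_profit (enc_ctree c p e) = Some (Num P, t4)" "t4 \<le> 60 * csize e"
    unfolding e sums P_def by (rule runsE)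
  have "2 * P + 1 < W" using M W by linarith
  from runs_thresholds[OF W(1) this, of m 1] obtain t5 where
    t5: "fcall W scheme fn_thresholds (Pair (Num P) (Pair (Num m) (Num 1))) =
      Some (enc_table (thresholds P m 1), t5)" "t5 \<le> 60 * L + 20"
    by (auto elim!: runsE simp: L_def base_table_def)
  have "2 * M < W" "sum c (set (cnodes e)) \<le> M" "\<forall>j\<in>set (cnodes e). Suc j < W" "distinct (cnodes e)"
    using W M names assms(2) unfolding e by force+
  from runs_dp[OF W(1) this(1) M(4) m(2) this(4,2,3), of p] obtain t6 where
    t6: "fcall W scheme fn_dp (Pair (enc_table (base_table P m)) (enc_ctree c p e)) =
      Some (enc_table (dp (base_table P m) c p e), t6)" "t6 \<le> 500 * L ^ 2 * csize e"
    unfolding L_def by (rule runsE)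
  from runs_pick[OF W(1), of C "dp (base_table P m) c p e" SEmpty] obtain t7 where
    t7: "fcall W scheme fn_pick (Pair (Num C) (Pair (enc_table (dp (base_table P m) c p e)) (Num 0))) =
      Some (enc_sol x, t7)" "t7 \<le> 100 * L + 30"
    by (auto elim!: runsE simp: L_def x_def)
  have dcn: "distinct (cnodes e)" using assms(2) e by simp
  have x: "set (snodes x) \<in> sels e" "ssize x \<le> csize e"
    using dp_pick[OF dcn m(2) _ empty_in_sels, of p P c C] unfolding x_def e P_def by auto
  have "\<forall>j\<in>set (snodes x). j < W"
    using sels_subset[OF x(1)] names W unfolding e by force
  from runs_flat[OF W(1) this, of "[]"] obtain t8 where
    t8: "fcall W scheme fn_flat (Pair (enc_sol x) (Num 0)) = Some (enc_list (map Num (snodes x)), t8)"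
      "t8 \<le> 60 * csize e"
    using x(2) by (auto elim!: runsE)

  have L1: "1 \<le> L" by (simp add: L_def base_table_def)
  \<comment> \<open>All cost terms are charged to this product, of which the tables take the main
    share.\<close>
  define Q where "Q = n * L ^ 2"
  have Q: "n \<le> Q" "L \<le> Q" "1 \<le> Q" "L ^ 2 * csize e \<le> 4 * Q"
  proof -
    have "L * 1 \<le> L * L" using L1 by (intro mult_le_mono2)
    then have L2: "L \<le> L ^ 2" "1 \<le> L ^ 2" using L1 by (auto simp: power2_eq_square)
    show "n \<le> Q" using mult_le_mono2[OF L2(2), of n] by (simp add: Q_def)
    show "L \<le> Q" using mult_le_mono[OF n1 L2(1)] by (simp add: Q_def)
    then show "1 \<le> Q" using L1 by linarith
    have "csize e \<le> 4 * n" using size n1 by linarith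
    then have "L ^ 2 * csize e \<le> L ^ 2 * (4 * n)" by (rule mult_le_mono2)
    then show "L ^ 2 * csize e \<le> 4 * Q" by (simp add: Q_def mult.commute mult.left_commute)
  qed
  have cs: "csize e \<le> 4 * n" using size n1 by linarith
  have base: "enc_table (base_table P m) =
      Pair (Pair (Num 0) (Pair (Num 0) (Num 0))) (enc_table (thresholds P m 1))"
    by (simp add: base_table_def)
  have "t6 \<le> 2000 * Q" using t6(2) Q(4) by simp
  then have cost: "t1 + t2 + t3 + t4 + t5 + t6 + t7 + t8 + 200 \<le> 5000 * Q"
    using t1(2) t2(2) t3(2) t4(2) t5(2) t7(2) t8(2) Q(1-3) cs by linarith
  have "runs W 0 (enc_input a b Js c p C) (enc_list (map Num (snodes x))) (5000 * Q)"
    using assms(3) W Wm Wm' t1(1) t2(1) t3(1) t4(1) t5(1) t6(1)[unfolded base] t7(1) t8(1) cost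
    unfolding m(1) resolution_def
    by (intro runsI) (auto simp: main_code_def enc_input_def mult.assoc)
  then show ?thesis
    unfolding x_def Q_def n_def L_def by (simp add: mult.assoc)
qed

section \<open>Optimal selections and the choice of the resolution\<close>

lemma feasible_iff: "feasible Js c C S \<longleftrightarrow> indep Js S \<and> sum c S \<le> C"
  by (auto simp: feasible_def indep_def)

lemma optimum_attained: "\<exists>S. feasible Js c C S \<and> optimum Js c p C = sum p S"
proof -
  let ?A = "{sum p S | S. feasible Js c C S}"
  have "?A \<subseteq> sum p ` Pow (set (forest_nodes Js))" by (auto simp: feasible_def)
  then have "finite ?A" by (rule finite_subset) simp
  moreover have "feasible Js c C {}" by (simp add: feasible_def disjoint_family_on_def)
  then have "?A \<noteq> {}" by blast
  ultimately have "optimum Js c p C \<in> ?A" unfolding optimum_def by (rule Max_in)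
  then show ?thesis by auto
qed

text \<open>The total loss is at most exp((D + 1)/m) \<le> exp(\<epsilon>/2) \<le> 1 + \<epsilon>/2
  + \<epsilon>^2/4, which is below 1 + \<epsilon> for \<epsilon> < 1.\<close>

lemma resolution_accuracy:
  fixes a b :: nat and \<epsilon> :: real and e :: ctree
  assumes "0 < a" and "0 < b" and "real a / real b \<le> \<epsilon>" and "\<epsilon> < 1"
  defines "m \<equiv> resolution a b e"
  shows "((real m + 1) / real m) ^ (jdepth e + 1) \<le> 1 + \<epsilon>"
proof -
  let ?d = "jdepth e + 1"
  have m: "0 < m" by (simp add: m_def resolution_def)
  have \<epsilon>: "0 < \<epsilon>" using assms by (metis divide_pos_pos less_le_trans of_nat_0_less_iff)
  have "2 * ?d * b < m * a"
    unfolding m_def resolution_def using assms(1)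
    by (metis Suc_eq_plus1 dividend_less_div_times mult_Suc add.commute)
  then have "2 * real ?d * real b < real m * real a"
    by (metis of_nat_less_iff of_nat_mult of_nat_numeral)
  then have "real ?d / real m \<le> real a / real b / 2"
    using m assms(2) by (simp add: field_simps)
  also have "\<dots> \<le> \<epsilon> / 2" using assms(3) by (intro divide_right_mono) auto
  finally have dm: "real ?d / real m \<le> \<epsilon> / 2" .
  have "((real m + 1) / real m) ^ ?d = (1 + 1 / real m) ^ ?d"
    using m by (simp add: add_divide_distrib)
  also have "\<dots> \<le> exp (1 / real m) ^ ?d"
    by (intro power_mono exp_ge_add_one_self) auto
  also have "\<dots> = exp (real ?d * (1 / real m))" by (rule exp_of_nat_mult[symmetric])
  also have "\<dots> \<le> exp (\<epsilon> / 2)" using dm by simp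
  also have "\<dots> \<le> 1 + \<epsilon> / 2 + (\<epsilon> / 2)\<^sup>2" using \<epsilon> assms(4) by (intro exp_bound) auto
  also have "\<dots> \<le> 1 + \<epsilon>"
    using mult_left_mono[of \<epsilon> 1 \<epsilon>] \<epsilon> assms(4) by (simp add: power2_eq_square field_simps)
  finally show ?thesis .
qed

text \<open>Here the fraction must not be too small: it gives b/a \<le> 2/\<epsilon>. With D + 1
  \<le> 3z this makes 12 z/\<epsilon>, and the final \<open>+ 1\<close> is absorbed since
  z/\<epsilon> is at least 1.\<close>

lemma resolution_le:
  assumes "0 < a" and "0 < b" and "0 < \<epsilon>" and "\<epsilon> < 1" and "\<epsilon> / 2 \<le> real a / real b"
    and "real (jdepth e) \<le> 2 * z" and "1 \<le> z"
  shows "real (resolution a b e) \<le> 13 * (z / \<epsilon>)"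
proof -
  have "real (2 * (jdepth e + 1) * b div a) \<le> real (2 * (jdepth e + 1) * b) / real a"
    by (rule of_nat_div_le_of_nat)
  also have "\<dots> = 2 * (real (jdepth e) + 1) * (real b / real a)"
    by (simp add: algebra_simps add_divide_distrib)
  also have "\<dots> \<le> 2 * (3 * z) * (2 / \<epsilon>)"
  proof (rule mult_mono)
    show "real b / real a \<le> 2 / \<epsilon>"
      using assms(1-3,5) by (simp add: field_simps)
  qed (use assms in auto)
  finally have "real (resolution a b e) \<le> 12 * (z / \<epsilon>) + 1" by (simp add: resolution_def)
  moreover have "1 \<le> z / \<epsilon>" using assms(3,4,7) by (simp add: le_divide_eq)
  ultimately show ?thesis by simp
qed

theorem theorem4:
  "\<exists>(P :: prog) (k :: nat) (K :: real).
     \<forall>(Js :: tree list) (c :: nat \<Rightarrow> nat) (p :: nat \<Rightarrow> nat) (C :: nat) (r0 :: nat) (n :: nat)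
       (a0 :: nat \<Rightarrow> real) (\<epsilon> :: real) (a :: nat) (b :: nat).
       Js \<noteq> [] \<and> distinct (forest_nodes Js) \<and> n = length (forest_nodes Js) \<and>
       r0 \<notin> set (forest_nodes Js) \<and>
       (\<Sum>j\<in>set (forest_nodes Js). real (p j + c j)) \<le> a0 n \<and>
       0 < \<epsilon> \<and> \<epsilon> < 1 \<and> given_by_fraction \<epsilon> a b \<longrightarrow>
       (\<exists>sel t.
          computes (magnitude (enc_input a b Js c p C) ^ k) P
            (enc_input a b Js c p C) (enc_list (map Num sel)) t \<and>
          distinct sel \<and> approx_solution \<epsilon> Js c p C (set sel) \<and>
          real t \<le> K * (real n * (lg (real (chi (Node r0 Js))) * lg (a0 n) / \<epsilon>)\<^sup>2))"
\<comment> \<open>The exponent 3 fixes the word size of \<open>runs_scheme\<close>; the constant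
  exceeds 5002 * 78^2.\<close>
proof (rule exI[of _ scheme], rule exI[of _ 3], rule exI[of _ 40000000], intro allI impI, elim conjE)
  fix Js :: "tree list" and c p :: "nat \<Rightarrow> nat" and C r0 n :: nat and a0 :: "nat \<Rightarrow> real"
    and \<epsilon> :: real and a b :: nat
  assume Js: "Js \<noteq> []" and dist: "distinct (forest_nodes Js)" and n: "n = length (forest_nodes Js)"
    and a0: "(\<Sum>j\<in>set (forest_nodes Js). real (p j + c j)) \<le> a0 n"
    and \<epsilon>: "0 < \<epsilon>" "\<epsilon> < 1" and frac: "given_by_fraction \<epsilon> a b"
  define e where "e = balance (map conv Js)"
  define P where "P = sum p (set (forest_nodes Js))"
  define m where "m = resolution a b e"
  define x where "x = pick C (dp (base_table P m) c p e) SEmpty"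
  define L where "L = length (base_table P m)"
  let ?W = "magnitude (enc_input a b Js c p C) ^ 3"
  let ?z = "lg (real (chi (Node r0 Js)))"
  let ?X = "?z * lg (a0 n) / \<epsilon>"
  have b: "0 < b" and ab: "\<epsilon> / 2 \<le> real a / real b" "real a / real b \<le> \<epsilon>"
    using frac by (auto simp: given_by_fraction_def)
  have a: "0 < a"
  proof (rule ccontr)
    assume "\<not> 0 < a"
    then show False using ab(1) \<epsilon> by simp
  qed
  have m: "0 < m" by (simp add: m_def resolution_def)
  have nodes: "cnodes e = forest_nodes Js" by (simp add: e_def cnodes_balance_conv)
  have sels: "S \<in> sels e \<longleftrightarrow> indep Js S" for S
    using indep_iff_sels[OF dist] unfolding e_def by blast

  obtain t where t: "fcall ?W scheme 0 (enc_input a b Js c p C) = Some (enc_list (map Num (snodes x)), t)"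
      "t \<le> 5000 * n * L ^ 2"
    using runs_scheme[OF Js dist a, of b c p C]
    unfolding n x_def L_def e_def[symmetric] P_def[symmetric] m_def[symmetric] by (rule runsE)
  \<comment> \<open>The outer call adds two steps, one for \<open>Var\<close> and one for
    \<open>Call\<close>.\<close>
  then have "eval ?W scheme [enc_input a b Js c p C] (Call 0 (Var 0)) (enc_list (map Num (snodes x))) (1 + t + 1)"
    using eval.Var[of 0 "[enc_input a b Js c p C]" ?W scheme]
    by (intro eval.Call) (auto simp: fcall_eq_Some)
  then have run: "computes ?W scheme (enc_input a b Js c p C) (enc_list (map Num (snodes x))) (t + 2)"
    by (simp add: computes_def)

  obtain S where S: "feasible Js c C S" "optimum Js c p C = sum p S"
    using optimum_attained by blast
  have "S \<in> sels e" "sum c S \<le> C" using S(1) by (auto simp: sels feasible_iff)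
  note pick = dp_pick[OF _ m _ this, of p P, folded x_def]
  have x: "set (snodes x) \<in> sels e" "distinct (snodes x)" "sum c (set (snodes x)) \<le> C"
    and profit: "m ^ (jdepth e + 1) * sum p S \<le> (m + 1) ^ (jdepth e + 1) * sum p (set (snodes x))"
    using pick dist unfolding nodes P_def by auto
  have "real (optimum Js c p C) \<le> (1 + \<epsilon>) * real (sum p (set (snodes x)))"
  proof -
    let ?d = "jdepth e + 1"
    have "real m ^ ?d * real (sum p S) \<le> (real m + 1) ^ ?d * real (sum p (set (snodes x)))"
      using iffD2[OF of_nat_le_iff[where 'a = real] profit] by (simp only: of_nat_mult of_nat_power of_nat_add of_nat_1)
    then have "real (sum p S) \<le> ((real m + 1) / real m) ^ ?d * real (sum p (set (snodes x)))"
      using m by (simp add: power_divide pos_le_divide_eq mult.commute del: power_Suc)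
    also have "\<dots> \<le> (1 + \<epsilon>) * real (sum p (set (snodes x)))"
      unfolding m_def by (intro mult_right_mono resolution_accuracy[OF a b ab(2) \<epsilon>(2)] of_nat_0_le_iff)
    finally show ?thesis using S(2) by simp
  qed
  then have approx: "approx_solution \<epsilon> Js c p C (set (snodes x))"
    using x by (auto simp: approx_solution_def feasible_iff sels)

  have z: "1 \<le> ?z" and lg: "1 \<le> lg (a0 n)" by (simp_all add: lg_def)
  have "real P \<le> (\<Sum>j\<in>set (forest_nodes Js). real (p j + c j))"
    unfolding P_def of_nat_sum by (intro sum_mono) simp
  then have "real L \<le> 6 * real m * lg (a0 n)"
    unfolding L_def using a0 by (intro length_base_table m) simp
  \<comment> \<open>Table length and resolution combine to the factor 78 = 6 * 13, whose square 6084
    enters the time bound.\<close>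
  also have "\<dots> \<le> 6 * (13 * (?z / \<epsilon>)) * lg (a0 n)"
    unfolding m_def using lg
    by (intro mult_right_mono mult_left_mono resolution_le a b \<epsilon> ab z) (auto simp: e_def jdepth_le_lg)
  finally have "real L \<le> 78 * ?X" by simp
  then have "real L ^ 2 \<le> (78 * ?X) ^ 2" by (intro power_mono) auto
  also have "(78 * ?X) ^ 2 = 6084 * ?X ^ 2" by (subst power_mult_distrib) simp
  finally have L2: "real L ^ 2 \<le> 6084 * ?X ^ 2" .
  have n1: "1 \<le> n" using Js length_le_forest_nodes[of Js] unfolding n
    by (metis One_nat_def Suc_leI length_greater_0_conv order_less_le_trans)
  have L1: "1 \<le> L ^ 2" by (simp add: L_def base_table_def)
  have "t + 2 \<le> 5002 * (n * L ^ 2)"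
  proof -
    have "1 \<le> n * L ^ 2" using mult_le_mono[OF n1 L1] by (simp only: mult_1)
    then show ?thesis using t(2) unfolding mult.assoc by linarith
  qed
  then have "real (t + 2) \<le> real (5002 * (n * L ^ 2))" by (simp only: of_nat_le_iff)
  also have "\<dots> = 5002 * (real n * real L ^ 2)" by simp
  also have "\<dots> \<le> 5002 * (real n * (6084 * ?X ^ 2))"
    using L2 by (intro mult_left_mono) auto
  also have "\<dots> = 30432168 * (real n * ?X ^ 2)" by simp
  also have "\<dots> \<le> 40000000 * (real n * ?X ^ 2)"
    by (intro mult_right_mono) auto
  finally show "\<exists>sel t. computes ?W scheme (enc_input a b Js c p C) (enc_list (map Num sel)) t \<and>
      distinct sel \<and> approx_solution \<epsilon> Js c p C (set sel) \<and>
      real t \<le> 40000000 * (real n * ?X ^ 2)"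
    using run x(2) approx by blast
qed

end
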